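(* Let $n\ge 1$ be an integer and let $\beta>0$ be real. The $m\times m$ matrix $$H_\beta=\left[\det(X_i+X_j)^{-\beta}\right]_{i,j=1}^m$$ is positive semidefinite for every integer $m\ge 1$ and all real symmetric positive definite $n\times n$ matrices $X_1,\dots,X_m$ if and only if $$\beta\in\left\{\tfrac{j}{2} : j\in\mathbb{N},\ 1\le j\le n-1\right\}\cup\left\{\gamma : \gamma\in\mathbb{R},\ \gamma>\tfrac12(n-1)\right\}.$$
   Context: Positive semidefinite means $c^*H_\beta c\ge 0$ for all vectors $c$. *)

theory Defs
  imports "Jordan_Normal_Form.Determinant"
begin

definition sym_pos_def :: "nat \<Rightarrow> real mat \<Rightarrow> bool" where
  "sym_pos_def n A \<longleftrightarrow>
     A \<in> carrier_mat n n \<and> transpose_mat A = A \<and>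
     (\<forall>x \<in> carrier_vec n. x \<noteq> 0\<^sub>v n \<longrightarrow> 0 < x \<bullet> (A *\<^sub>v x))"

(* The order on complex numbers is the one of HOL-Library.Complex_Order: 0 \<le> z says that
   z is real and nonnegative. *)
definition pos_semidef :: "complex mat \<Rightarrow> bool" where
  "pos_semidef A \<longleftrightarrow>
     square_mat A \<and> (\<forall>c \<in> carrier_vec (dim_row A). 0 \<le> conjugate c \<bullet> (A *\<^sub>v c))"

(* Matrix indices start at 0, so the family X_1, ..., X_m is X 0, ..., X (m - 1). For positive
   definite X i and X j the base of powr is positive, so powr is the usual real power. *)
definition det_power_mat :: "real \<Rightarrow> nat \<Rightarrow> (nat \<Rightarrow> real mat) \<Rightarrow> real mat" where
  "det_power_mat \<beta> m X = mat m m (\<lambda>(i, j). det (X i + X j) powr (- \<beta>))"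

end

theory Submission
  imports Defs "HOL-Probability.Probability" "HOL-Real_Asymp.Real_Asymp"
begin

text \<open>
  Write \<open>M = A + B\<close> and \<open>Q\<^sub>M(v) = v \<bullet> M\<^sup>-\<^sup>1 v\<close>. Everything is an induction on the size of the matrices that
  relates the kernel \<open>det (X + Y) powr -\<beta>\<close> in dimension \<open>n + 1\<close> to the kernel with exponent
  \<open>\<beta> - 1/2\<close> in dimension \<open>n\<close>, for \<open>\<beta> > 0\<close>.

  Upwards: if \<open>X\<close> and \<open>Y\<close> have corners \<open>a, b\<close>, borders \<open>u, w\<close> and lower blocks \<open>A, B\<close>, then
  \<open>det (X + Y) = det M * (a + b - Q\<^sub>M(u + w))\<close>. The power of the Schur complement is a Gamma integral of
  exponentials, and \<open>det M powr -1/2 * exp Q\<^sub>M(u + w)\<close> is a Gaussian integral of rank one kernels.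

  Downwards: for \<open>X = [[1/t, y\<^sup>T/t], [y/t, A + y y\<^sup>T/t]]\<close> the determinant is, up to a product of a function
  of \<open>X\<close> and a function of \<open>Y\<close>, \<open>det M * (t + u + Q\<^sub>M(y - z))\<close>. Second differences in \<open>t\<close> raise the
  exponent of the second factor by 2, and in the limit that factor becomes \<open>exp (- Q\<^sub>M(y - z))\<close>. Averaging
  over \<open>y\<close> and \<open>z\<close> with wide Gaussian weights then leaves a factor \<open>det M powr 1/2\<close>.

  Downward steps from an excluded exponent end at a negative exponent in positive dimension, where
  already two scalar matrices violate positivity.
\<close>

hide_const (open) Determinants.det Finite_Cartesian_Product.vec Finite_Cartesian_Product.mat
  Finite_Cartesian_Product.row Finite_Cartesian_Product.column
hide_type (open) Finite_Cartesian_Product.vec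
unbundle no vec_syntax
unbundle no inner_syntax

section \<open>Bordered matrices\<close>

definition bordered :: "real \<Rightarrow> real vec \<Rightarrow> real mat \<Rightarrow> real mat" where
  "bordered a g C = four_block_mat (mat 1 1 (\<lambda>_. a)) (mat 1 (dim_row C) (\<lambda>(_, j). g $ j))
     (mat (dim_row C) 1 (\<lambda>(i, _). g $ i)) C"

lemma bordered_carrier [simp]:
  "C \<in> carrier_mat k k \<Longrightarrow> bordered a g C \<in> carrier_mat (Suc k) (Suc k)"
  unfolding bordered_def by (auto simp: carrier_matD)

lemma dim_bordered [simp]:
  "dim_row (bordered a g C) = Suc (dim_row C)" "dim_col (bordered a g C) = Suc (dim_col C)"
  unfolding bordered_def by auto

lemma bordered_index:
  assumes "C \<in> carrier_mat k k" "i < Suc k" "j < Suc k"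
  shows "bordered a g C $$ (i, j) =
    (if i = 0 then if j = 0 then a else g $ (j - 1)
     else if j = 0 then g $ (i - 1) else C $$ (i - 1, j - 1))"
  using assms unfolding bordered_def by (auto simp: carrier_matD)

lemma bordered_add:
  assumes "C \<in> carrier_mat k k" "D \<in> carrier_mat k k" "g \<in> carrier_vec k" "h \<in> carrier_vec k"
  shows "bordered a g C + bordered b h D = bordered (a + b) (g + h) (C + D)"
proof (rule eq_matI)
  have c: "C + D \<in> carrier_mat k k" using assms by auto
  fix i j assume "i < dim_row (bordered (a + b) (g + h) (C + D))"
    "j < dim_col (bordered (a + b) (g + h) (C + D))"
  then have ij: "i < Suc k" "j < Suc k" using assms by auto
  show "(bordered a g C + bordered b h D) $$ (i, j) = bordered (a + b) (g + h) (C + D) $$ (i, j)"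
    using assms ij bordered_carrier[OF assms(2), of b h]
    by (auto simp: bordered_index[OF c] bordered_index[OF assms(1)] bordered_index[OF assms(2)])
qed (insert assms bordered_carrier[of "C + D" k] bordered_carrier[OF assms(1)] bordered_carrier[OF assms(2)], auto)

lemma bordered_symmetric:
  assumes "C \<in> carrier_mat k k"
  shows "transpose_mat (bordered a g C) = bordered a g C \<longleftrightarrow> transpose_mat C = C"
proof
  assume *: "transpose_mat (bordered a g C) = bordered a g C"
  show "transpose_mat C = C"
  proof (rule eq_matI)
    fix i j assume "i < dim_row C" "j < dim_col C"
    then have "i < k" "j < k" using assms by auto
    then show "transpose_mat C $$ (i, j) = C $$ (i, j)"
      using arg_cong[OF *, of "\<lambda>M. M $$ (Suc i, Suc j)"] assms bordered_carrier[OF assms, of a g]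
      by (auto simp: bordered_index[OF assms])
  qed (insert assms, auto)
next
  assume *: "transpose_mat C = C"
  have s: "C $$ (i, j) = C $$ (j, i)" if "i < k" "j < k" for i j
    using arg_cong[OF *, of "\<lambda>M. M $$ (i, j)"] that assms by auto
  show "transpose_mat (bordered a g C) = bordered a g C"
    using carrier_matD[OF assms] by (intro eq_matI) (auto simp: bordered_index[OF assms] s)
qed

lemma symmetric_mat_Suc_cases:
  assumes "X \<in> carrier_mat (Suc k) (Suc k)" "transpose_mat X = X"
  obtains a g C where "X = bordered a g C" "g \<in> carrier_vec k" "C \<in> carrier_mat k k"
    "transpose_mat C = C"
proof -
  define g where "g = vec k (\<lambda>i. X $$ (Suc i, 0))"
  define C where "C = mat k k (\<lambda>(i, j). X $$ (Suc i, Suc j))"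
  have C: "C \<in> carrier_mat k k" by (simp add: C_def)
  have s: "X $$ (i, j) = X $$ (j, i)" if "i < Suc k" "j < Suc k" for i j
    using arg_cong[OF assms(2), of "\<lambda>M. M $$ (i, j)"] that assms(1) by auto
  have X: "X = bordered (X $$ (0, 0)) g C"
  proof (rule eq_matI)
    fix i j assume "i < dim_row (bordered (X $$ (0, 0)) g C)" "j < dim_col (bordered (X $$ (0, 0)) g C)"
    then have ij: "i < Suc k" "j < Suc k" using C by auto
    then show "X $$ (i, j) = bordered (X $$ (0, 0)) g C $$ (i, j)"
      using s[OF ij] unfolding bordered_index[OF C ij]
      by (cases i; cases j) (auto simp: g_def C_def)
  qed (use assms(1) C in auto)
  have "transpose_mat C = C"
    using assms(2) bordered_symmetric[OF C] X by metis
  then show ?thesis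
    by (intro that[OF X _ C]) (auto simp: g_def)
qed

lemma bordered_mult_vCons:
  assumes "C \<in> carrier_mat k k" "g \<in> carrier_vec k" "q \<in> carrier_vec k"
  shows "bordered a g C *\<^sub>v vCons p q = vCons (a * p + g \<bullet> q) (p \<cdot>\<^sub>v g + C *\<^sub>v q)"
proof (rule eq_vecI)
  have r: "row (bordered a g C) 0 = vCons a g"
    by (rule eq_vecI) (insert assms bordered_carrier[OF assms(1), of a g],
      auto simp: bordered_index[OF assms(1)] vec_index_vCons)
  have r': "row (bordered a g C) (Suc i) = vCons (g $ i) (row C i)" if "i < k" for i
    by (rule eq_vecI) (insert assms that bordered_carrier[OF assms(1), of a g],
      auto simp: bordered_index[OF assms(1)] vec_index_vCons)
  fix i assume "i < dim_vec (vCons (a * p + g \<bullet> q) (p \<cdot>\<^sub>v g + C *\<^sub>v q))"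
  then have i: "i < Suc k" using assms by auto
  show "(bordered a g C *\<^sub>v vCons p q) $ i = vCons (a * p + g \<bullet> q) (p \<cdot>\<^sub>v g + C *\<^sub>v q) $ i"
    using i assms bordered_carrier[OF assms(1), of a g]
    by (cases i) (auto simp: r r' vec_index_vCons)
qed (use assms bordered_carrier[OF assms(1), of a g] in auto)

lemma bordered_quadratic_form:
  assumes "C \<in> carrier_mat k k" "g \<in> carrier_vec k" "q \<in> carrier_vec k"
  shows "vCons p q \<bullet> (bordered a g C *\<^sub>v vCons p q) = a * p\<^sup>2 + 2 * p * (g \<bullet> q) + q \<bullet> (C *\<^sub>v q)"
proof -
  have "q \<bullet> (p \<cdot>\<^sub>v g + C *\<^sub>v q) = p * (g \<bullet> q) + q \<bullet> (C *\<^sub>v q)"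
    using assms by (subst scalar_prod_add_distrib[of _ k]) (auto simp: comm_scalar_prod[of q k g])
  then show ?thesis
    by (simp add: bordered_mult_vCons[OF assms] power2_eq_square algebra_simps)
qed

text \<open>Column elimination: right multiplication by the unipotent \<open>?T\<close> subtracts
  from the first column the combination of the others with coefficients \<open>x\<close>, and
  \<open>C x = g\<close> clears the border below the corner. The solution \<open>x\<close> stands in
  for the inverse of \<open>C\<close>.\<close>

lemma det_bordered_schur:
  assumes C: "C \<in> carrier_mat k k" and g: "g \<in> carrier_vec k" and x: "x \<in> carrier_vec k"
    and eq: "C *\<^sub>v x = g"
  shows "det (bordered a g C) = (a - g \<bullet> x) * det C"
proof -
  let ?T = "four_block_mat (1\<^sub>m 1) (0\<^sub>m 1 k) (mat k 1 (\<lambda>(i, _). - x $ i)) (1\<^sub>m k)"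
  have gi: "row C i \<bullet> x = g $ i" if "i < k" for i
    using arg_cong[OF eq, of "\<lambda>v. v $ i"] that C by auto
  have T: "?T \<in> carrier_mat (Suc k) (Suc k)"
    by (rule carrier_matI) auto
  have dT: "det ?T = 1"
    by (subst det_four_block_mat_upper_right_zero[of _ 1 _ k]) auto
  have "bordered a g C * ?T = four_block_mat (mat 1 1 (\<lambda>_. a - g \<bullet> x)) (mat 1 k (\<lambda>(_, j). g $ j)) (0\<^sub>m k 1) C"
    unfolding bordered_def
    using C g x gi
    by (subst mult_four_block_mat[of _ 1 1 _ k _ k _ _ 1 _ k])
       (auto intro!: cong_four_block_mat eq_matI simp: scalar_prod_def sum_negf)
  moreover have "det \<dots> = (a - g \<bullet> x) * det C"
    using C by (subst det_four_block_mat_lower_left_zero[of _ 1 _ k]) (auto simp: det_single)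
  moreover have "det (bordered a g C * ?T) = det (bordered a g C)"
    using det_mult[OF bordered_carrier[OF C] T, of a g] dT by simp
  ultimately show ?thesis by simp
qed

text \<open>The same elimination with the corner as pivot. The corner may be negative, which
  \<open>det_rank_one_update\<close> exploits.\<close>

lemma det_bordered_corner:
  assumes C: "C \<in> carrier_mat k k" and g: "g \<in> carrier_vec k" and a: "a \<noteq> 0"
  shows "det (bordered a g C) = a * det (mat k k (\<lambda>(i, j). C $$ (i, j) - g $ i * g $ j / a))"
proof -
  let ?T = "four_block_mat (1\<^sub>m 1) (mat 1 k (\<lambda>(_, j). - g $ j / a)) (0\<^sub>m k 1) (1\<^sub>m k)"
  let ?S = "mat k k (\<lambda>(i, j). C $$ (i, j) - g $ i * g $ j / a)"
  have T: "?T \<in> carrier_mat (Suc k) (Suc k)"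
    by (rule carrier_matI) auto
  have dT: "det ?T = 1"
    by (subst det_four_block_mat_lower_left_zero[of _ 1 _ k]) auto
  have "bordered a g C * ?T = four_block_mat (mat 1 1 (\<lambda>_. a)) (0\<^sub>m 1 k) (mat k 1 (\<lambda>(i, _). g $ i)) ?S"
    unfolding bordered_def
    using C g a
    by (subst mult_four_block_mat[of _ 1 1 _ k _ k _ _ 1 _ k])
       (auto intro!: cong_four_block_mat eq_matI simp: scalar_prod_def)
  moreover have "det \<dots> = a * det ?S"
    using C by (subst det_four_block_mat_upper_right_zero[of _ 1 _ k]) (auto simp: det_single)
  moreover have "det (bordered a g C * ?T) = det (bordered a g C)"
    using det_mult[OF bordered_carrier[OF C] T, of a g] dT by simp
  ultimately show ?thesis by simp
qed

section \<open>Positive definite matrices and Schur complements\<close>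

lemma sym_pos_defD:
  assumes "sym_pos_def n A"
  shows "A \<in> carrier_mat n n" "transpose_mat A = A"
    and "\<And>x. x \<in> carrier_vec n \<Longrightarrow> x \<noteq> 0\<^sub>v n \<Longrightarrow> 0 < x \<bullet> (A *\<^sub>v x)"
  using assms by (auto simp: sym_pos_def_def)

lemma uminus_eq_smult: "- v = (- 1 :: real) \<cdot>\<^sub>v v"
  by (intro eq_vecI) auto

lemma sym_pos_def_add:
  assumes "sym_pos_def n A" "sym_pos_def n B"
  shows "sym_pos_def n (A + B)"
proof -
  note A = sym_pos_defD[OF assms(1)] and B = sym_pos_defD[OF assms(2)]
  have "x \<bullet> ((A + B) *\<^sub>v x) = x \<bullet> (A *\<^sub>v x) + x \<bullet> (B *\<^sub>v x)" if "x \<in> carrier_vec n" for x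
    using A(1) B(1) that
    by (simp add: add_mult_distrib_mat_vec[of _ n n] scalar_prod_add_distrib[of _ n])
  moreover have "transpose_mat (A + B) = A + B"
    using A B by (simp add: transpose_add[of _ n n])
  ultimately show ?thesis
    using A B by (auto simp: sym_pos_def_def intro!: add_pos_pos)
qed

lemma symmetric_scalar_prod:
  assumes "C \<in> carrier_mat k k" "transpose_mat C = (C :: real mat)" "x \<in> carrier_vec k" "y \<in> carrier_vec k"
  shows "(C *\<^sub>v x) \<bullet> y = x \<bullet> (C *\<^sub>v y)"
proof -
  have "(C *\<^sub>v x) \<bullet> y = y \<bullet> (C *\<^sub>v x)"
    using assms by (intro comm_scalar_prod[of _ k]) auto
  also have "\<dots> = (transpose_mat C *\<^sub>v y) \<bullet> x"
    using assms by (metis transpose_vec_mult_scalar)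
  also have "\<dots> = x \<bullet> (C *\<^sub>v y)"
    using assms by (subst comm_scalar_prod[of _ k]) auto
  finally show ?thesis .
qed

lemma sym_pos_def_Suc_cases:
  assumes "sym_pos_def (Suc k) X"
  obtains a g C where "X = bordered a g C" "g \<in> carrier_vec k" "sym_pos_def k C"
proof -
  note X = sym_pos_defD[OF assms]
  obtain a g C where Xeq: "X = bordered a g C" and g: "g \<in> carrier_vec k" and C: "C \<in> carrier_mat k k"
    and Cs: "transpose_mat C = C"
    using symmetric_mat_Suc_cases[OF X(1,2)] by blast
  have "0 < q \<bullet> (C *\<^sub>v q)" if q: "q \<in> carrier_vec k" "q \<noteq> 0\<^sub>v k" for q
    using X(3)[of "vCons 0 q"] q unfolding Xeq bordered_quadratic_form[OF C g q(1)]
    by (simp add: zero_vec_Suc)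
  then have "sym_pos_def k C" using C Cs by (auto simp: sym_pos_def_def)
  then show ?thesis using that Xeq g by blast
qed

text \<open>Among vectors with first entry 1 the form is smallest at \<open>vCons 1 (- x)\<close>,
  and its value there is the Schur complement.\<close>

lemma sym_pos_def_bordered_schur_pos:
  assumes X: "sym_pos_def (Suc k) (bordered a g C)" and C: "C \<in> carrier_mat k k"
    and x: "x \<in> carrier_vec k" and eq: "C *\<^sub>v x = g"
  shows "0 < a - g \<bullet> x"
proof -
  have g: "g \<in> carrier_vec k" using mult_mat_vec_carrier[OF C x] eq by simp
  have m: "C *\<^sub>v (- x) = - g"
    using mult_mat_vec[OF C x, of "- 1"] eq x g by (simp add: uminus_eq_smult)
  have "0 < vCons 1 (- x) \<bullet> (bordered a g C *\<^sub>v vCons 1 (- x))"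
    using sym_pos_defD(3)[OF X, of "vCons 1 (- x)"] x by (simp add: zero_vec_Suc)
  then show ?thesis
    using x g C unfolding bordered_quadratic_form[OF C g uminus_carrier_vec[THEN iffD2, OF x]] m
    by (simp add: comm_scalar_prod[of x k g])
qed

section \<open>Linear systems and the quadratic form of the inverse\<close>

lemma sym_pos_def_solve:
  assumes "sym_pos_def k M" "v \<in> carrier_vec k"
  shows "\<exists>x \<in> carrier_vec k. M *\<^sub>v x = v"
  using assms
proof (induction k arbitrary: M v)
  case 0
  then show ?case by (intro bexI[of _ v]) (auto intro!: eq_vecI simp: sym_pos_def_def)
next
  case (Suc k)
  obtain a g C where M: "M = bordered a g C" and g: "g \<in> carrier_vec k" and C: "sym_pos_def k C"
    using sym_pos_def_Suc_cases[OF Suc.prems(1)] .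
  note Cd = sym_pos_defD[OF C]
  obtain p q where v: "v = vCons p q" and q: "q \<in> carrier_vec k"
    using Suc.prems(2) by (cases v) auto
  obtain x where x: "x \<in> carrier_vec k" "C *\<^sub>v x = g" using Suc.IH[OF C g] by blast
  obtain y where y: "y \<in> carrier_vec k" "C *\<^sub>v y = q" using Suc.IH[OF C q] by blast
  have s: "0 < a - g \<bullet> x"
    using sym_pos_def_bordered_schur_pos[OF Suc.prems(1)[unfolded M] Cd(1) x] .
  \<comment> \<open>The lower block forces \<open>w = y - z x\<close>; the first row then becomes a
    scalar equation for \<open>z\<close> whose coefficient is the Schur complement.\<close>
  define z where "z = (p - g \<bullet> y) / (a - g \<bullet> x)"
  define w where "w = y - z \<cdot>\<^sub>v x"
  have w: "w \<in> carrier_vec k" using x y by (simp add: w_def)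
  have Cw: "C *\<^sub>v w = q - z \<cdot>\<^sub>v g"
    unfolding w_def using x y Cd(1)
    by (simp add: mult_minus_distrib_mat_vec[of _ k k] mult_mat_vec[of _ k k])
  have gw: "g \<bullet> w = g \<bullet> y - z * (g \<bullet> x)"
    unfolding w_def using x(1) y(1) g by (simp add: scalar_prod_minus_distrib[of _ k])
  have "z * (a - g \<bullet> x) = p - g \<bullet> y" using s by (simp add: z_def)
  then have "a * z + g \<bullet> w = p" unfolding gw by (simp add: algebra_simps)
  moreover have "z \<cdot>\<^sub>v g + C *\<^sub>v w = q"
    unfolding Cw using q g by (intro eq_vecI) auto
  ultimately have "M *\<^sub>v vCons z w = v"
    unfolding M v bordered_mult_vCons[OF Cd(1) g w] by simp
  then show ?case using w by (intro bexI[of _ "vCons z w"]) auto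
qed

text \<open>The quadratic form of \<open>M\<^sup>-\<^sup>1\<close>; \<open>SOME\<close> is meaningful only if \<open>M x = v\<close> has a solution.\<close>

definition inv_form :: "real mat \<Rightarrow> real vec \<Rightarrow> real" where
  "inv_form M v = v \<bullet> (SOME x. x \<in> carrier_vec (dim_row M) \<and> M *\<^sub>v x = v)"

text \<open>Symmetry moves \<open>M\<close> across the scalar product, so the value does not depend
  on which solution the choice operator picks.\<close>

lemma inv_form_eq:
  assumes "M \<in> carrier_mat k k" "transpose_mat M = M" "x \<in> carrier_vec k" "M *\<^sub>v x = v"
  shows "inv_form M v = v \<bullet> x"
proof -
  define y where "y = (SOME x. x \<in> carrier_vec (dim_row M) \<and> M *\<^sub>v x = v)"
  have "y \<in> carrier_vec (dim_row M) \<and> M *\<^sub>v y = v"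
    unfolding y_def by (rule someI[of _ x]) (use assms in auto)
  then have y: "y \<in> carrier_vec k" "M *\<^sub>v y = v" using assms(1) by auto
  have v: "v \<in> carrier_vec k" using assms by auto
  have "inv_form M v = (M *\<^sub>v x) \<bullet> y"
    unfolding inv_form_def y_def[symmetric] assms(4) ..
  also have "\<dots> = x \<bullet> (M *\<^sub>v y)" by (rule symmetric_scalar_prod[OF assms(1-3) y(1)])
  also have "\<dots> = v \<bullet> x" using comm_scalar_prod[OF v assms(3)] y by simp
  finally show ?thesis .
qed

lemma det_bordered:
  assumes "sym_pos_def k C" "g \<in> carrier_vec k"
  shows "det (bordered a g C) = (a - inv_form C g) * det C"
proof -
  note C = sym_pos_defD[OF assms(1)]
  obtain x where x: "x \<in> carrier_vec k" "C *\<^sub>v x = g" using sym_pos_def_solve[OF assms] by blast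
  show ?thesis
    using det_bordered_schur[OF C(1) assms(2) x] inv_form_eq[OF C(1,2) x] by simp
qed

lemma sym_pos_def_bordered_pos:
  assumes "sym_pos_def (Suc k) (bordered a g C)" "sym_pos_def k C" "g \<in> carrier_vec k"
  shows "0 < a - inv_form C g"
proof -
  note C = sym_pos_defD[OF assms(2)]
  obtain x where x: "x \<in> carrier_vec k" "C *\<^sub>v x = g" using sym_pos_def_solve[OF assms(2,3)] by blast
  show ?thesis
    using sym_pos_def_bordered_schur_pos[OF assms(1) C(1) x] inv_form_eq[OF C(1,2) x] by simp
qed

lemma sym_pos_def_det_pos: "sym_pos_def k M \<Longrightarrow> 0 < det M"
proof (induction k arbitrary: M)
  case 0
  then show ?case by (simp add: sym_pos_def_def)
next
  case (Suc k)
  obtain a g C where M: "M = bordered a g C" and g: "g \<in> carrier_vec k" and C: "sym_pos_def k C"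
    using sym_pos_def_Suc_cases[OF Suc.prems(1)] .
  show ?case
    using Suc.IH[OF C] sym_pos_def_bordered_pos[OF _ C g] Suc.prems
    unfolding M det_bordered[OF C g] by simp
qed

lemma inv_form_nonneg:
  assumes "sym_pos_def k M" "v \<in> carrier_vec k"
  shows "0 \<le> inv_form M v"
proof -
  note M = sym_pos_defD[OF assms(1)]
  obtain x where x: "x \<in> carrier_vec k" "M *\<^sub>v x = v" using sym_pos_def_solve[OF assms] by blast
  have "inv_form M v = x \<bullet> (M *\<^sub>v x)"
    using inv_form_eq[OF M(1,2) x] x comm_scalar_prod[OF x(1) assms(2)] by simp
  moreover have "\<dots> = 0" if "x = 0\<^sub>v k" using that M(1) x assms(2) by simp
  ultimately show ?thesis using M(3)[OF x(1)] by force
qed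

lemma inv_form_smult:
  assumes "sym_pos_def k M" "v \<in> carrier_vec k"
  shows "inv_form M (t \<cdot>\<^sub>v v) = t\<^sup>2 * inv_form M v"
proof -
  note M = sym_pos_defD[OF assms(1)]
  obtain x where x: "x \<in> carrier_vec k" "M *\<^sub>v x = v" using sym_pos_def_solve[OF assms] by blast
  have "M *\<^sub>v (t \<cdot>\<^sub>v x) = t \<cdot>\<^sub>v v" using M(1) x by (simp add: mult_mat_vec[of _ k k])
  from inv_form_eq[OF M(1,2) _ this] inv_form_eq[OF M(1,2) x] x assms(2) show ?thesis
    by (simp add: power2_eq_square)
qed

text \<open>Completing the square in the first coordinate: the term in \<open>p\<close> is a
  one-dimensional Gaussian exponent centred at \<open>x \<bullet> q\<close>. With
  \<open>det_bordered\<close> this lets multivariate Gaussians be treated one variable at a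
  time.\<close>

lemma inv_form_bordered:
  assumes X: "sym_pos_def (Suc k) (bordered a g C)" and C: "sym_pos_def k C"
    and g: "g \<in> carrier_vec k" and x: "x \<in> carrier_vec k" "C *\<^sub>v x = g" and q: "q \<in> carrier_vec k"
  shows "inv_form (bordered a g C) (vCons p q)
    = (p - x \<bullet> q)\<^sup>2 / (a - inv_form C g) + inv_form C q"
proof -
  note Xd = sym_pos_defD[OF X] and Cd = sym_pos_defD[OF C]
  obtain y where y: "y \<in> carrier_vec k" "C *\<^sub>v y = q" using sym_pos_def_solve[OF C q] by blast
  have gy: "g \<bullet> y = x \<bullet> q"
    using symmetric_scalar_prod[OF Cd(1,2) x(1) y(1)] x y by simp
  have qx: "q \<bullet> x = x \<bullet> q" by (rule comm_scalar_prod[OF q x(1)])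
  have ig: "inv_form C g = g \<bullet> x" by (rule inv_form_eq[OF Cd(1,2) x])
  have s: "0 < a - g \<bullet> x" using sym_pos_def_bordered_pos[OF X C g] ig by simp
  define z where "z = (p - x \<bullet> q) / (a - g \<bullet> x)"
  define w where "w = y - z \<cdot>\<^sub>v x"
  have w: "w \<in> carrier_vec k" using x y by (simp add: w_def)
  have Cw: "C *\<^sub>v w = q - z \<cdot>\<^sub>v g"
    unfolding w_def using x y Cd(1)
    by (simp add: mult_minus_distrib_mat_vec[of _ k k] mult_mat_vec[of _ k k])
  have gw: "g \<bullet> w = x \<bullet> q - z * (g \<bullet> x)"
    unfolding w_def using x(1) y(1) g by (simp add: scalar_prod_minus_distrib[of _ k] gy)
  have qw: "q \<bullet> w = q \<bullet> y - z * (x \<bullet> q)"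
    unfolding w_def using x(1) y(1) q by (simp add: scalar_prod_minus_distrib[of _ k] qx)
  have "z * (a - g \<bullet> x) = p - x \<bullet> q" using s by (simp add: z_def)
  then have "a * z + g \<bullet> w = p" unfolding gw by (simp add: algebra_simps)
  moreover have "z \<cdot>\<^sub>v g + C *\<^sub>v w = q"
    unfolding Cw using q g by (intro eq_vecI) auto
  ultimately have "bordered a g C *\<^sub>v vCons z w = vCons p q"
    unfolding bordered_mult_vCons[OF Cd(1) g w] by simp
  from inv_form_eq[OF Xd(1,2) _ this] w
  have "inv_form (bordered a g C) (vCons p q) = p * z + q \<bullet> w" by simp
  also have "\<dots> = (p - x \<bullet> q) * z + q \<bullet> y" unfolding qw by (simp add: algebra_simps)
  also have "q \<bullet> y = inv_form C q" using inv_form_eq[OF Cd(1,2) y] by simp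
  finally show ?thesis by (simp add: z_def ig power2_eq_square)
qed

section \<open>Gaussian integrals and limits\<close>

lemma tendsto_second_difference_powr:
  fixes s \<gamma> :: real assumes "s > 0"
  shows "((\<lambda>h. ((s + 2 * h) powr (-\<gamma>) - 2 * (s + h) powr (-\<gamma>) + s powr (-\<gamma>)) / h\<^sup>2)
    \<longlongrightarrow> \<gamma> * (\<gamma> + 1) * s powr (-\<gamma> - 2)) (at_right 0)"
proof -
  have "((\<lambda>h. ((s + 2 * h) powr (-\<gamma>) - 2 * (s + h) powr (-\<gamma>) + s powr (-\<gamma>)) / h\<^sup>2)
    \<longlongrightarrow> - (\<gamma> * (inverse s * (inverse s * ((- \<gamma> - 1) * s powr - \<gamma>))))) (at_right 0)"
    using assms by real_asymp
  moreover have "s powr (-\<gamma> - 2) = s powr (-\<gamma>) * inverse s * inverse s"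
    using assms by (simp add: powr_diff power2_eq_square divide_inverse)
  ultimately show ?thesis by (simp add: algebra_simps)
qed
lemma tendsto_powr_exp: "((\<lambda>N::nat. (1 + Q / (2 * real N)) powr (-(\<beta> + 2 * real N))) \<longlongrightarrow> exp (-Q)) at_top"
  by real_asymp
text \<open>The centre \<open>c\<close> is absent from the limit: a Gaussian averaged against ever
  wider weights remembers only its own width. The factor \<open>2 * \<sigma>\<close> compensates the
  decay of the mean.\<close>

lemma tendsto_wide_gaussian: "((\<lambda>\<sigma>. 2 * \<sigma> * (sqrt (s / (s + 4 * \<sigma>\<^sup>2)) * exp (- (c\<^sup>2) / (s + 4 * \<sigma>\<^sup>2)))) \<longlongrightarrow> sqrt s) at_top" if "s > 0" for s :: real
proof -
  have "2 * (s / 4) powr (1 / 2) = sqrt s" using that by (simp add: powr_half_sqrt real_sqrt_divide)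
  moreover have "((\<lambda>\<sigma>. 2 * \<sigma> * (sqrt (s / (s + 4 * \<sigma>\<^sup>2)) * exp (- (c\<^sup>2) / (s + 4 * \<sigma>\<^sup>2)))) \<longlongrightarrow> 2 * (s / 4) powr (1 / 2)) at_top"
   using that by real_asymp
  ultimately show ?thesis by simp
qed
lemma gaussian_integral:
  fixes s p :: real assumes "s > 0"
  shows "((\<lambda>z. exp (- s * z\<^sup>2 + 2 * p * z)) has_integral sqrt (pi / s) * exp (p\<^sup>2 / s)) UNIV"
proof -
  \<comment> \<open>The integrand is a multiple of the normal density with mean \<open>p / s\<close>
    and variance \<open>1 / (2 * s)\<close>.\<close>
  define r where "r = 1 / sqrt (2 * s)"
  have r: "r > 0" "r\<^sup>2 = 1 / (2 * s)" using assms by (auto simp: r_def power_divide)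
  have eq: "exp (- s * z\<^sup>2 + 2 * p * z) = sqrt (pi / s) * exp (p\<^sup>2 / s) * normal_density (p / s) r z" for z
  proof -
    have "- s * z\<^sup>2 + 2 * p * z = p\<^sup>2 / s + - (z - p / s)\<^sup>2 / (2 * r\<^sup>2)"
      using assms unfolding r(2) by (simp add: field_simps power2_eq_square)
    then have "exp (- s * z\<^sup>2 + 2 * p * z) = exp (p\<^sup>2 / s) * exp (- (z - p / s)\<^sup>2 / (2 * r\<^sup>2))"
      by (simp only: exp_add)
    moreover have "2 * pi * r\<^sup>2 = pi / s" using assms by (simp add: r)
    ultimately show ?thesis using assms by (simp add: normal_density_def)
  qed
  have "(normal_density (p / s) r has_integral 1) UNIV"
    using has_integral_integral_lborel[OF integrable_normal_density[OF r(1)], of "p/s"]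
      integral_normal_density[OF r(1)] by simp
  then show ?thesis unfolding eq by (rule has_integral_mult_right[where c = "sqrt (pi / s) * exp (p\<^sup>2 / s)" and y = 1, simplified mult_1_right])
qed

section \<open>Gaussian weights\<close>

definition gaussian_measure :: "real \<Rightarrow> real measure" where
  "gaussian_measure \<sigma> = density lborel (normal_density 0 \<sigma>)"

lemma sets_gaussian_measure [simp, measurable_cong]: "sets (gaussian_measure \<sigma>) = sets borel"
  by (simp add: gaussian_measure_def)

lemma prob_space_gaussian_measure: "\<sigma> > 0 \<Longrightarrow> prob_space (gaussian_measure \<sigma>)"
  unfolding gaussian_measure_def by (rule prob_space_normal_density)

text \<open>Up to scale, \<open>exp (- z\<^sup>2 / s)\<close> is a normal density of variance
  \<open>s / 2\<close>, and variances add under convolution.\<close>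

lemma gaussian_measure_convolution:
  assumes "\<sigma> > 0" "s > 0"
  shows "(\<integral>y. exp (- (x - y)\<^sup>2 / s) \<partial>gaussian_measure \<sigma>)
    = sqrt (s / (s + 2 * \<sigma>\<^sup>2)) * exp (- x\<^sup>2 / (s + 2 * \<sigma>\<^sup>2))"
proof -
  define t where "t = sqrt (s / 2)"
  have t: "t > 0" "t\<^sup>2 = s / 2" using assms by (auto simp: t_def)
  have e: "exp (- z\<^sup>2 / s) = sqrt (pi * s) * normal_density 0 t z" for z
    using assms by (simp add: normal_density_def t)
  have pos: "0 < t\<^sup>2 + \<sigma>\<^sup>2" using assms t by (simp add: add_pos_nonneg)
  have "has_bochner_integral lborel (\<lambda>y. normal_density 0 t (x - y) * normal_density 0 \<sigma> y)
      (normal_density 0 (sqrt (t\<^sup>2 + \<sigma>\<^sup>2)) x)"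
    using fun_cong[OF conv_normal_density_zero_mean[OF t(1) assms(1)], of x]
    by (intro has_bochner_integral_nn_integral) auto
  then have "(\<integral>y. normal_density 0 t (x - y) * normal_density 0 \<sigma> y \<partial>lborel)
      = normal_density 0 (sqrt (t\<^sup>2 + \<sigma>\<^sup>2)) x"
    by (rule has_bochner_integral_integral_eq)
  moreover have "(\<integral>y. exp (- (x - y)\<^sup>2 / s) \<partial>gaussian_measure \<sigma>)
      = (\<integral>y. sqrt (pi * s) * (normal_density 0 t (x - y) * normal_density 0 \<sigma> y) \<partial>lborel)"
    unfolding gaussian_measure_def
    by (subst integral_density) (auto simp: e[simplified] mult_ac)
  moreover have "normal_density 0 (sqrt (t\<^sup>2 + \<sigma>\<^sup>2)) x
      = exp (- x\<^sup>2 / (s + 2 * \<sigma>\<^sup>2)) / sqrt (pi * (s + 2 * \<sigma>\<^sup>2))"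
  proof -
    define A where "A = t\<^sup>2 + \<sigma>\<^sup>2"
    have "(sqrt (t\<^sup>2 + \<sigma>\<^sup>2))\<^sup>2 = t\<^sup>2 + \<sigma>\<^sup>2" using pos by simp
    moreover have "2 * (t\<^sup>2 + \<sigma>\<^sup>2) = s + 2 * \<sigma>\<^sup>2" "2 * pi * (t\<^sup>2 + \<sigma>\<^sup>2) = pi * (s + 2 * \<sigma>\<^sup>2)"
      by (simp_all add: t algebra_simps)
    ultimately show ?thesis
      unfolding normal_density_def A_def[symmetric] by simp
  qed
  ultimately show ?thesis
    by (simp add: real_sqrt_mult real_sqrt_divide)
qed

section \<open>Positive semidefinite kernels\<close>

text \<open>Points form an indexed family, so they may repeat. \<open>K\<close> need not be
  symmetric; the form sees only its symmetric part.\<close>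

definition psd_on :: "'a set \<Rightarrow> ('a \<Rightarrow> 'a \<Rightarrow> real) \<Rightarrow> bool" where
  "psd_on S K \<longleftrightarrow> (\<forall>(m::nat) x c. (\<forall>i<m. x i \<in> S) \<longrightarrow>
     0 \<le> (\<Sum>i<m. \<Sum>j<m. c i * c j * K (x i) (x j)))"

lemma psd_onI:
  assumes "\<And>(m::nat) x c. (\<And>i. i < m \<Longrightarrow> x i \<in> S) \<Longrightarrow> 0 \<le> (\<Sum>i<m. \<Sum>j<m. c i * c j * K (x i) (x j))"
  shows "psd_on S K"
  using assms unfolding psd_on_def by blast

lemma psd_onD:
  assumes "psd_on S K" "\<And>i. i < m \<Longrightarrow> x i \<in> S"
  shows "0 \<le> (\<Sum>i<(m::nat). \<Sum>j<m. c i * c j * K (x i) (x j))"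
  using assms unfolding psd_on_def by blast

lemma psd_on_sum:
  assumes "psd_on S K" "finite I" "\<And>i. i \<in> I \<Longrightarrow> x i \<in> S"
  shows "0 \<le> (\<Sum>i\<in>I. \<Sum>j\<in>I. c i * c j * K (x i) (x j))"
proof -
  obtain h where h: "bij_betw h {..<card I} I"
    using ex_bij_betw_nat_finite[OF assms(2)] by (auto simp: atLeast0LessThan)
  have "0 \<le> (\<Sum>i<card I. \<Sum>j<card I. c (h i) * c (h j) * K (x (h i)) (x (h j)))"
    using assms(3) bij_betwE[OF h] by (intro psd_onD[OF assms(1)]) auto
  also have "\<dots> = (\<Sum>i<card I. \<Sum>j\<in>I. c (h i) * c j * K (x (h i)) (x j))"
    by (intro sum.cong refl sum.reindex_bij_betw[OF h])
  also have "\<dots> = (\<Sum>i\<in>I. \<Sum>j\<in>I. c i * c j * K (x i) (x j))"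
    by (rule sum.reindex_bij_betw[OF h])
  finally show ?thesis .
qed

lemma psd_on_cong:
  assumes "psd_on S K" "\<And>x y. x \<in> S \<Longrightarrow> y \<in> S \<Longrightarrow> K x y = J x y"
  shows "psd_on S J"
proof (rule psd_onI)
  fix m :: nat and x :: "nat \<Rightarrow> 'a" and c :: "nat \<Rightarrow> real"
  assume x: "\<And>i. i < m \<Longrightarrow> x i \<in> S"
  have "(\<Sum>i<m. \<Sum>j<m. c i * c j * K (x i) (x j)) = (\<Sum>i<m. \<Sum>j<m. c i * c j * J (x i) (x j))"
    using x assms(2) by (intro sum.cong refl) auto
  then show "0 \<le> (\<Sum>i<m. \<Sum>j<m. c i * c j * J (x i) (x j))"
    using psd_onD[OF assms(1), where m = m and x = x and c = c] x by simp
qed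

text \<open>The factor \<open>g\<close> is absorbed into the coefficients. With \<open>f\<close> the
  identity, this is multiplication by a rank one kernel.\<close>

lemma psd_on_compose:
  assumes "psd_on S K" "\<And>x. x \<in> T \<Longrightarrow> f x \<in> S"
  shows "psd_on T (\<lambda>x y. g x * g y * K (f x) (f y))"
proof (rule psd_onI)
  fix m :: nat and x :: "nat \<Rightarrow> 'b" and c :: "nat \<Rightarrow> real"
  assume x: "\<And>i. i < m \<Longrightarrow> x i \<in> T"
  show "0 \<le> (\<Sum>i<m. \<Sum>j<m. c i * c j * (g (x i) * g (x j) * K (f (x i)) (f (x j))))"
    using psd_onD[OF assms(1), where m = m and x = "\<lambda>i. f (x i)" and c = "\<lambda>i. c i * g (x i)"] x assms(2)
    by (simp add: mult_ac)
qed

lemma psd_on_const: "0 \<le> r \<Longrightarrow> psd_on S (\<lambda>_ _. r)"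
proof (rule psd_onI)
  fix m :: nat and x :: "nat \<Rightarrow> 'a" and c :: "nat \<Rightarrow> real"
  assume "0 \<le> r"
  moreover have "(\<Sum>i<m. \<Sum>j<m. c i * c j * r) = r * (\<Sum>i<m. c i)\<^sup>2"
    by (simp add: power2_eq_square sum_product sum_distrib_left mult_ac)
  ultimately show "0 \<le> (\<Sum>i<m. \<Sum>j<m. c i * c j * r)" by simp
qed

lemma psd_on_scale:
  assumes "psd_on S K" "0 \<le> r"
  shows "psd_on S (\<lambda>x y. r * K x y)"
  using psd_on_compose[OF assms(1), where T = S and f = "\<lambda>x. x" and g = "\<lambda>_. sqrt r"] assms(2) by simp

lemma psd_on_tendsto:
  fixes S :: "'a set"
  assumes "F \<noteq> bot" "\<forall>\<^sub>F t in F. psd_on S (K t)"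
    and "\<And>x y. x \<in> S \<Longrightarrow> y \<in> S \<Longrightarrow> ((\<lambda>t. K t x y) \<longlongrightarrow> J x y) F"
  shows "psd_on S J"
proof (rule psd_onI)
  fix m :: nat and x :: "nat \<Rightarrow> 'a" and c :: "nat \<Rightarrow> real"
  assume x: "\<And>i. i < m \<Longrightarrow> x i \<in> S"
  have "((\<lambda>t. \<Sum>i<m. \<Sum>j<m. c i * c j * K t (x i) (x j)) \<longlongrightarrow> (\<Sum>i<m. \<Sum>j<m. c i * c j * J (x i) (x j))) F"
    using x assms(3) by (intro tendsto_sum tendsto_mult tendsto_const) auto
  moreover have "\<forall>\<^sub>F t in F. 0 \<le> (\<Sum>i<m. \<Sum>j<m. c i * c j * K t (x i) (x j))"
    using assms(2) by eventually_elim (rule psd_onD, use x in auto)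
  ultimately show "0 \<le> (\<Sum>i<m. \<Sum>j<m. c i * c j * J (x i) (x j))"
    using tendsto_lowerbound assms(1) by blast
qed

lemma psd_on_has_integral:
  fixes S :: "'a set" and T :: "real set"
  assumes "\<And>t. t \<in> T \<Longrightarrow> psd_on S (K t)"
    and "\<And>x y. x \<in> S \<Longrightarrow> y \<in> S \<Longrightarrow> ((\<lambda>t. K t x y) has_integral J x y) T"
  shows "psd_on S J"
proof (rule psd_onI)
  fix m :: nat and x :: "nat \<Rightarrow> 'a" and c :: "nat \<Rightarrow> real"
  assume x: "\<And>i. i < m \<Longrightarrow> x i \<in> S"
  have "((\<lambda>t. \<Sum>i<m. \<Sum>j<m. c i * c j * K t (x i) (x j)) has_integral (\<Sum>i<m. \<Sum>j<m. c i * c j * J (x i) (x j))) T"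
    using x assms(2) by (intro has_integral_sum has_integral_mult_right) auto
  then show "0 \<le> (\<Sum>i<m. \<Sum>j<m. c i * c j * J (x i) (x j))"
    by (rule has_integral_nonneg) (use x in \<open>auto intro!: psd_onD[OF assms(1)]\<close>)
qed

text \<open>Each index is used twice: \<open>f (x i)\<close> with coefficient \<open>c i\<close> and
  \<open>g (x i)\<close> with coefficient \<open>- c i\<close>.\<close>

lemma psd_on_difference:
  assumes "psd_on S K" "\<And>x. x \<in> T \<Longrightarrow> f x \<in> S" "\<And>x. x \<in> T \<Longrightarrow> g x \<in> S"
  shows "psd_on T (\<lambda>x y. K (f x) (f y) - K (f x) (g y) - K (g x) (f y) + K (g x) (g y))"
proof (rule psd_onI)
  fix m :: nat and x :: "nat \<Rightarrow> 'b" and c :: "nat \<Rightarrow> real"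
  assume x: "\<And>i. i < m \<Longrightarrow> x i \<in> T"
  define h where "h = (\<lambda>(i, b). if b then f (x i) else g (x i))"
  define d where "d = (\<lambda>(i, b). if b then c i else - c i)"
  have "0 \<le> (\<Sum>p\<in>{..<m} \<times> (UNIV::bool set). \<Sum>q\<in>{..<m} \<times> (UNIV::bool set). d p * d q * K (h p) (h q))"
    by (rule psd_on_sum[OF assms(1)]) (use x assms(2,3) in \<open>auto simp: h_def\<close>)
  also have "\<dots> = (\<Sum>i<m. \<Sum>j<m. c i * c j * (K (f (x i)) (f (x j)) - K (f (x i)) (g (x j))
      - K (g (x i)) (f (x j)) + K (g (x i)) (g (x j))))"
    unfolding sum.cartesian_product' UNIV_bool h_def d_def
    by (simp add: sum.distrib[symmetric]) (intro sum.cong refl; simp add: algebra_simps)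
  finally show "0 \<le> \<dots>" .
qed

section \<open>From powers to exponentials\<close>

lemma psd_on_raise_exponent:
  assumes psd: "psd_on (S \<times> {0<..}) (\<lambda>(a, t) (b, u). L a b * (t + u + Q a b) powr (- \<gamma>))"
    and Q: "\<And>a b. a \<in> S \<Longrightarrow> b \<in> S \<Longrightarrow> 0 \<le> Q a b" and \<gamma>: "\<gamma> > 0"
  shows "psd_on (S \<times> {0<..}) (\<lambda>(a, t) (b, u). L a b * (t + u + Q a b) powr (- \<gamma> - 2))"
proof -
  let ?K = "\<lambda>(a, t) (b, u). L a b * (t + u + Q a b) powr (- \<gamma>)"
  let ?D = "\<lambda>h s. (s + 2 * h) powr (- \<gamma>) - 2 * (s + h) powr (- \<gamma>) + s powr (- \<gamma>)"
  \<comment> \<open>Two differentiations of the power produce the factor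
    \<open>\<gamma> * (\<gamma> + 1)\<close>, which is divided out together with
    \<open>h\<^sup>2\<close>.\<close>
  let ?r = "\<lambda>h. 1 / (\<gamma> * (\<gamma> + 1) * h\<^sup>2)"
  have "psd_on (S \<times> {0<..}) (\<lambda>(a, t) (b, u). ?r h * (L a b * ?D h (t + u + Q a b)))" if h: "h > 0" for h
  proof -
    \<comment> \<open>The power depends on \<open>t\<close> and \<open>u\<close> only through
      \<open>t + u\<close>, so shifting each by \<open>h\<close> turns the mixed difference into the
      second difference \<open>?D\<close> in one variable.\<close>
    have "psd_on (S \<times> {0<..}) (\<lambda>p q. ?K (fst p, snd p + h) (fst q, snd q + h) - ?K (fst p, snd p + h) q
        - ?K p (fst q, snd q + h) + ?K p q)"
      using h by (intro psd_on_difference[OF psd, where g = "\<lambda>p. p"]) auto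
    from psd_on_scale[OF this, of "?r h"] \<gamma> have "psd_on (S \<times> {0<..}) (\<lambda>p q. ?r h * (?K (fst p, snd p + h) (fst q, snd q + h) - ?K (fst p, snd p + h) q
        - ?K p (fst q, snd q + h) + ?K p q))" by simp
    then show ?thesis
      by (rule psd_on_cong) (auto simp: algebra_simps)
  qed
  then have "\<forall>\<^sub>F h in at_right 0. psd_on (S \<times> {0<..}) (\<lambda>(a, t) (b, u). ?r h * (L a b * ?D h (t + u + Q a b)))"
    by (auto simp: eventually_at_filter)
  then show ?thesis
  proof (rule psd_on_tendsto[rotated])
    fix p q assume "p \<in> S \<times> {0::real<..}" "q \<in> S \<times> {0::real<..}"
    then obtain a t b u where pq: "p = (a, t)" "q = (b, u)" "a \<in> S" "b \<in> S" "t > 0" "u > 0" by auto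
    define s where "s = t + u + Q a b"
    have s: "s > 0" using pq Q[of a b] by (simp add: s_def)
    have "((\<lambda>h. L a b / (\<gamma> * (\<gamma> + 1)) * (?D h s / h\<^sup>2)) \<longlongrightarrow>
        L a b / (\<gamma> * (\<gamma> + 1)) * (\<gamma> * (\<gamma> + 1) * s powr (- \<gamma> - 2))) (at_right 0)"
      by (intro tendsto_mult tendsto_const tendsto_second_difference_powr s)
    then show "((\<lambda>h. (case p of (a, t) \<Rightarrow> \<lambda>(b, u). ?r h * (L a b * ?D h (t + u + Q a b))) q)
        \<longlongrightarrow> (case p of (a, t) \<Rightarrow> \<lambda>(b, u). L a b * (t + u + Q a b) powr (- \<gamma> - 2)) q) (at_right 0)"
      using \<gamma> by (simp add: pq s_def mult_ac)
  qed simp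
qed

text \<open>Each use of \<open>psd_on_raise_exponent\<close> adds 2 to \<open>\<gamma>\<close> and
  keeps \<open>L\<close> and \<open>Q\<close>. At \<open>t = u = N\<close> the base is
  \<open>2 * N * (1 + Q / (2 * N))\<close>; after division by a power of \<open>2 * N\<close> the
  limit is the compound interest formula.\<close>

lemma psd_on_exp_limit:
  assumes psd: "psd_on (S \<times> {0<..}) (\<lambda>(a, t) (b, u). L a b * (t + u + Q a b) powr (- \<gamma>))"
    and Q: "\<And>a b. a \<in> S \<Longrightarrow> b \<in> S \<Longrightarrow> 0 \<le> Q a b" and \<gamma>: "\<gamma> > 0"
  shows "psd_on S (\<lambda>a b. L a b * exp (- Q a b))"
proof -
  have *: "psd_on (S \<times> {0<..}) (\<lambda>(a, t) (b, u). L a b * (t + u + Q a b) powr (- (\<gamma> + 2 * real N)))" for N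
  proof (induction N)
    case (Suc N)
    then show ?case using psd_on_raise_exponent[OF Suc Q] \<gamma> by (simp add: algebra_simps)
  qed (use psd in simp)
  have "psd_on S (\<lambda>a b. L a b * (1 + Q a b / (2 * real N)) powr (- (\<gamma> + 2 * real N)))" if N: "N > 0" for N
  proof -
    have "psd_on S (\<lambda>a b. (2 * real N) powr (\<gamma> + 2 * real N) * (L a b * (real N + real N + Q a b) powr (- (\<gamma> + 2 * real N))))"
      using psd_on_compose[OF *[of N], where T = S and f = "\<lambda>a. (a, real N)" and g = "\<lambda>_. 1"] N
      by (intro psd_on_scale) auto
    then show ?thesis
    proof (rule psd_on_cong)
      fix a b assume ab: "a \<in> S" "b \<in> S"
      have "real N + real N + Q a b = (2 * real N) * (1 + Q a b / (2 * real N))" using N by (simp add: field_simps)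
      moreover have "((2 * real N) * (1 + Q a b / (2 * real N))) powr (- (\<gamma> + 2 * real N))
        = (2 * real N) powr (- (\<gamma> + 2 * real N)) * (1 + Q a b / (2 * real N)) powr (- (\<gamma> + 2 * real N))"
        by (rule powr_mult)
      moreover have "(2 * real N) powr (\<gamma> + 2 * real N) * (2 * real N) powr (- (\<gamma> + 2 * real N)) = 1"
        using N by (simp add: powr_add[symmetric])
      ultimately show "(2 * real N) powr (\<gamma> + 2 * real N) * (L a b * (real N + real N + Q a b) powr (- (\<gamma> + 2 * real N)))
        = L a b * (1 + Q a b / (2 * real N)) powr (- (\<gamma> + 2 * real N))"
        by (simp add: mult_ac)
    qed
  qed
  then show ?thesis
    by (intro psd_on_tendsto[of at_top S "\<lambda>N a b. L a b * (1 + Q a b / (2 * real N)) powr (- (\<gamma> + 2 * real N))"]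
        tendsto_mult tendsto_const tendsto_powr_exp) (auto simp: eventually_at_top_linorder intro!: exI[of _ 1])
qed

section \<open>Averages of kernels\<close>

lemma psd_on_average:
  fixes F :: "real \<Rightarrow> real \<Rightarrow> real"
  assumes psd: "psd_on UNIV F" and M: "prob_space M" and sets [measurable_cong]: "sets M = sets borel"
    and meas [measurable]: "(\<lambda>(x, y). F x y) \<in> borel_measurable (borel \<Otimes>\<^sub>M borel)"
    and bound: "\<And>x y. \<bar>F x y\<bar> \<le> B"
  shows "0 \<le> (\<integral>x. (\<integral>y. F x y + F y x \<partial>M) \<partial>M)"
proof -
  interpret prob_space M by fact
  have int: "integrable M f" if "f \<in> borel_measurable borel" "\<And>x. \<bar>f x\<bar> \<le> c" for f :: "real \<Rightarrow> real" and c
    using that by (intro integrable_const_bound[where B = c]) auto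
  \<comment> \<open>Both orders are kept because \<open>F\<close> need not be symmetric. Thus
    \<open>J\<close> is the contribution of an unordered pair of random points, which explains the
    count \<open>m * (m - 1) / 2\<close> below.\<close>
  define U where "U x = (\<integral>y. F x y + F y x \<partial>M)" for x
  have bound': "\<bar>F x y + F y x\<bar> \<le> B + B" for x y
    using bound[of x y] bound[of y x] by linarith
  have intF: "integrable M (\<lambda>y. F x y + F y x)" for x
    by (rule int[OF _ bound']) measurable
  have intD: "integrable M (\<lambda>y. F y y)"
    by (rule int[of _ B]) (auto intro: bound)
  have U_meas: "U \<in> borel_measurable borel"
    unfolding U_def by measurable
  have U_bound: "\<bar>U x\<bar> \<le> B + B" for x
  proof -
    have "\<bar>U x\<bar> \<le> (\<integral>y. \<bar>F x y + F y x\<bar> \<partial>M)" unfolding U_def by (rule integral_abs_bound)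
    also have "\<dots> \<le> (\<integral>y. B + B \<partial>M)"
      by (intro integral_mono integrable_abs intF bound') auto
    finally show ?thesis by (simp add: prob_space)
  qed
  have intU: "integrable M U" by (rule int[OF U_meas U_bound])
  define D J where "D = (\<integral>y. F y y \<partial>M)" and "J = (\<integral>x. U x \<partial>M)"
  \<comment> \<open>The right-hand side is the expectation of the total kernel sum over the \<open>k\<close> points \<open>x i\<close> and
    \<open>m\<close> further independent random points; for large \<open>m\<close> the double integral \<open>J\<close> dominates.\<close>
  have main: "0 \<le> (\<Sum>i<k. \<Sum>j<k. F (x i) (x j)) + real m * (\<Sum>i<k. U (x i)) + real m * D + real (m * (m - 1)) / 2 * J"
    for m k :: nat and x :: "nat \<Rightarrow> real"
  proof (induction m arbitrary: k x)
    case 0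
    then show ?case using psd_onD[OF psd, where m = k and x = x and c = "\<lambda>_. 1"] by simp
  next
    case (Suc m)
    let ?S = "\<Sum>i<k. \<Sum>j<k. F (x i) (x j)"
    let ?G = "\<lambda>y. ?S + (\<Sum>i<k. F (x i) y + F y (x i)) + F y y
      + real m * ((\<Sum>i<k. U (x i)) + U y) + (real m * D + real (m * (m - 1)) / 2 * J)"
    \<comment> \<open>One random point \<open>y\<close> is frozen as an additional fixed point at
      index \<open>k\<close>; the induction hypothesis is then integrated over
      \<open>y\<close>.\<close>
    have "0 \<le> ?G y" for y
      using Suc.IH[of "x(k := y)" "Suc k"] by (simp add: sum.distrib algebra_simps)
    then have "0 \<le> (\<integral>y. ?G y \<partial>M)" by simp
    also have "(\<integral>y. ?G y \<partial>M) = ?S + (\<Sum>i<k. U (x i)) + D + real m * ((\<Sum>i<k. U (x i)) + J)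
        + (real m * D + real (m * (m - 1)) / 2 * J)"
      using intF intD intU by (simp add: prob_space U_def[symmetric] D_def J_def Bochner_Integration.integral_sum)
    also have "\<dots> = ?S + real (Suc m) * (\<Sum>i<k. U (x i)) + real (Suc m) * D + real (Suc m * (Suc m - 1)) / 2 * J"
      by (cases m) (simp_all add: field_simps)
    finally show ?case .
  qed
  have "0 \<le> J"
  proof (rule ccontr)
    assume "\<not> 0 \<le> J"
    then have J: "J < 0" by simp
    obtain n :: nat where "2 * D / (- J) < real n" using reals_Archimedean2 by blast
    then have "2 * D + real n * J < 0" using J by (simp add: field_simps)
    then have "real (Suc n) * (2 * D + real n * J) < 0" by (intro mult_pos_neg) auto
    moreover have "0 \<le> real (Suc n) * D + real (Suc n * n) / 2 * J"
      using main[of _ 0 "Suc n"] by simp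
    ultimately show False by (simp add: field_simps)
  qed
  then show ?thesis by (simp add: J_def U_def)
qed

lemma integral_double_sum:
  fixes w :: "nat \<Rightarrow> nat \<Rightarrow> real"
  assumes "\<And>i j. i < m \<Longrightarrow> j < m \<Longrightarrow> integrable M (f i j)" "\<And>i j. i < m \<Longrightarrow> j < m \<Longrightarrow> integrable M (g i j)"
  shows "(\<integral>y. (\<Sum>i<m. \<Sum>j<m. w i j * (f i j y + g i j y)) \<partial>M)
    = (\<Sum>i<m. \<Sum>j<m. w i j * ((\<integral>y. f i j y \<partial>M) + (\<integral>y. g i j y \<partial>M)))"
  using assms
  by (intro has_bochner_integral_integral_eq has_bochner_integral_sum has_bochner_integral_mult_right
      has_bochner_integral_add has_bochner_integral_integrable) auto

text \<open>Integrate \<open>x\<close> and \<open>y\<close> against independent centred Gaussians of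
  width \<open>\<sigma>\<close>, multiply by \<open>2 * \<sigma>\<close> and let
  \<open>\<sigma>\<close> tend to infinity. The centres \<open>c a b\<close> disappear in the limit,
  so they may depend on the pair in any way.\<close>

lemma psd_on_gaussian_average:
  assumes psd: "psd_on (S \<times> UNIV) (\<lambda>(a, x) (b, y). L a b * exp (- (x - y - c a b)\<^sup>2 / s a b))"
    and s: "\<And>a b. a \<in> S \<Longrightarrow> b \<in> S \<Longrightarrow> 0 < s a b"
  shows "psd_on S (\<lambda>a b. L a b * sqrt (s a b))"
proof -
  \<comment> \<open>Each of two convolutions adds \<open>2 * \<sigma>\<^sup>2\<close> to the
    denominator \<open>s a b\<close>. Swapping \<open>x\<close> and \<open>y\<close> changes the
    sign of \<open>c a b\<close>, which enters only through its square.\<close>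
  define I where "I \<sigma> a b = sqrt (s a b / (s a b + 4 * \<sigma>\<^sup>2)) * exp (- (c a b)\<^sup>2 / (s a b + 4 * \<sigma>\<^sup>2))" for \<sigma> a b
  have I: "(\<integral>x. (\<integral>y. exp (- (x - y - c a b)\<^sup>2 / s a b) \<partial>gaussian_measure \<sigma>) \<partial>gaussian_measure \<sigma>) = I \<sigma> a b"
    "(\<integral>x. (\<integral>y. exp (- (y - x - c a b)\<^sup>2 / s a b) \<partial>gaussian_measure \<sigma>) \<partial>gaussian_measure \<sigma>) = I \<sigma> a b"
    if "\<sigma> > 0" "a \<in> S" "b \<in> S" for \<sigma> a b
  proof -
    let ?s = "s a b" and ?c = "c a b"
    have s': "0 < ?s + 2 * \<sigma>\<^sup>2" using s[OF that(2,3)] by (simp add: add_pos_nonneg)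
    have *: "(\<integral>x. (\<integral>y. exp (- (x - c - y)\<^sup>2 / ?s) \<partial>gaussian_measure \<sigma>) \<partial>gaussian_measure \<sigma>)
      = sqrt (?s / (?s + 4 * \<sigma>\<^sup>2)) * exp (- c\<^sup>2 / (?s + 4 * \<sigma>\<^sup>2))" for c
    proof -
      have "(\<integral>x. (\<integral>y. exp (- (x - c - y)\<^sup>2 / ?s) \<partial>gaussian_measure \<sigma>) \<partial>gaussian_measure \<sigma>)
        = sqrt (?s / (?s + 2 * \<sigma>\<^sup>2)) * (\<integral>x. exp (- (c - x)\<^sup>2 / (?s + 2 * \<sigma>\<^sup>2)) \<partial>gaussian_measure \<sigma>)"
        by (simp add: gaussian_measure_convolution[OF that(1) s[OF that(2,3)], simplified] power2_commute[where y = c])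
      also have "\<dots> = sqrt (?s / (?s + 2 * \<sigma>\<^sup>2)) * (sqrt ((?s + 2 * \<sigma>\<^sup>2) / (?s + 2 * \<sigma>\<^sup>2 + 2 * \<sigma>\<^sup>2))
          * exp (- c\<^sup>2 / (?s + 2 * \<sigma>\<^sup>2 + 2 * \<sigma>\<^sup>2)))"
        using gaussian_measure_convolution[OF that(1) s', of c] by simp
      also have "?s + 2 * \<sigma>\<^sup>2 + 2 * \<sigma>\<^sup>2 = ?s + 4 * \<sigma>\<^sup>2" by simp
      finally show ?thesis using s' by (simp add: real_sqrt_divide)
    qed
    show "(\<integral>x. (\<integral>y. exp (- (x - y - ?c)\<^sup>2 / ?s) \<partial>gaussian_measure \<sigma>) \<partial>gaussian_measure \<sigma>) = I \<sigma> a b"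
    proof -
      have "x - y - ?c = x - ?c - y" for x y by simp
      then show ?thesis using *[of ?c] unfolding I_def by (simp only:)
    qed
    have "(y - x - ?c)\<^sup>2 = (x - (- ?c) - y)\<^sup>2" for x y
      by (simp add: power2_eq_square algebra_simps)
    then show "(\<integral>x. (\<integral>y. exp (- (y - x - ?c)\<^sup>2 / ?s) \<partial>gaussian_measure \<sigma>) \<partial>gaussian_measure \<sigma>) = I \<sigma> a b"
      using *[of "- ?c"] by (simp add: I_def)
  qed
  have int: "integrable (gaussian_measure \<sigma>) (\<lambda>y. exp (- (x - y - d)\<^sup>2 / r))" 
     "integrable (gaussian_measure \<sigma>) (\<lambda>y. exp (- (y - x - d)\<^sup>2 / r))" if "\<sigma> > 0" "r > 0" for \<sigma> x d r
  proof -
    interpret prob_space "gaussian_measure \<sigma>" by (rule prob_space_gaussian_measure[OF that(1)])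
    show "integrable (gaussian_measure \<sigma>) (\<lambda>y. exp (- (x - y - d)\<^sup>2 / r))"
      "integrable (gaussian_measure \<sigma>) (\<lambda>y. exp (- (y - x - d)\<^sup>2 / r))"
      using that(2) by (auto intro!: integrable_const_bound[where B = 1])
  qed
  \<comment> \<open>Integrating out \<open>y\<close> leaves a constant times a wider Gaussian in
    \<open>x\<close>, so \<open>int\<close> applies again.\<close>
  have int2: "integrable (gaussian_measure \<sigma>) (\<lambda>x. (\<integral>y. exp (- (x - y - d)\<^sup>2 / r) \<partial>gaussian_measure \<sigma>))"
     "integrable (gaussian_measure \<sigma>) (\<lambda>x. (\<integral>y. exp (- (y - x - d)\<^sup>2 / r) \<partial>gaussian_measure \<sigma>))"
    if "\<sigma> > 0" "r > 0" for \<sigma> d r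
  proof -
    have r: "0 < r + 2 * \<sigma>\<^sup>2" using that by (simp add: add_pos_nonneg)
    have "(\<integral>y. exp (- (x - y - d)\<^sup>2 / r) \<partial>gaussian_measure \<sigma>)
        = sqrt (r / (r + 2 * \<sigma>\<^sup>2)) * exp (- (x - 0 - d)\<^sup>2 / (r + 2 * \<sigma>\<^sup>2))" for x
    proof -
      have "x - y - d = (x - d) - y" for y by simp
      then show ?thesis using gaussian_measure_convolution[OF that, of "x - d"] by (simp only: diff_zero)
    qed
    then show "integrable (gaussian_measure \<sigma>) (\<lambda>x. (\<integral>y. exp (- (x - y - d)\<^sup>2 / r) \<partial>gaussian_measure \<sigma>))"
      by (simp only: integrable_mult_right int[OF that(1) r])
    have "(\<integral>y. exp (- (y - x - d)\<^sup>2 / r) \<partial>gaussian_measure \<sigma>)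
        = sqrt (r / (r + 2 * \<sigma>\<^sup>2)) * exp (- (x - 0 - (- d))\<^sup>2 / (r + 2 * \<sigma>\<^sup>2))" for x
    proof -
      have "(y - x - d)\<^sup>2 = ((x + d) - y)\<^sup>2" for y by (simp add: power2_eq_square algebra_simps)
      then show ?thesis
        using gaussian_measure_convolution[OF that, of "x + d"] by (simp only: diff_zero diff_minus_eq_add)
    qed
    then show "integrable (gaussian_measure \<sigma>) (\<lambda>x. (\<integral>y. exp (- (y - x - d)\<^sup>2 / r) \<partial>gaussian_measure \<sigma>))"
      by (simp only: integrable_mult_right int[OF that(1) r])
  qed
  have "psd_on S (\<lambda>a b. L a b * I \<sigma> a b)" if "\<sigma> > 0" for \<sigma>
  proof (rule psd_onI)
    fix m :: nat and p :: "nat \<Rightarrow> 'a" and d :: "nat \<Rightarrow> real"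
    assume p: "\<And>i. i < m \<Longrightarrow> p i \<in> S"
    let ?e = "\<lambda>i j t. exp (- (t - c (p i) (p j))\<^sup>2 / s (p i) (p j))"
    \<comment> \<open>With the points \<open>p\<close> and coefficients \<open>d\<close> frozen, a
      kernel on the real line remains. Testing it at \<open>x k\<close> with weights
      \<open>e k\<close> amounts to testing the given kernel at the pairs \<open>(p i, x k)\<close>
      with weights \<open>e k * d i\<close>.\<close>
    define F where "F x y = (\<Sum>i<m. \<Sum>j<m. d i * d j * L (p i) (p j) * ?e i j (x - y))" for x y
    have "psd_on UNIV F"
    proof (rule psd_onI)
      fix n :: nat and x e :: "nat \<Rightarrow> real"
      define q where "q = (\<lambda>(k, i). (p i, x k))"
      define f where "f = (\<lambda>(k, i). e k * d i)"
      have "0 \<le> (\<Sum>u\<in>{..<n} \<times> {..<m}. \<Sum>v\<in>{..<n} \<times> {..<m}. f u * f v *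
          (case q u of (a, x) \<Rightarrow> \<lambda>(b, y). L a b * exp (- (x - y - c a b)\<^sup>2 / s a b)) (q v))"
        using p by (intro psd_on_sum[OF psd]) (auto simp: q_def)
      also have "\<dots> = (\<Sum>k<n. \<Sum>i<m. \<Sum>l<n. \<Sum>j<m. e k * e l * (d i * d j * L (p i) (p j) * ?e i j (x k - x l)))"
        unfolding sum.cartesian_product' by (simp add: q_def f_def mult_ac)
      also have "\<dots> = (\<Sum>k<n. \<Sum>l<n. e k * e l * F (x k) (x l))"
        unfolding F_def sum_distrib_left by (intro sum.cong refl sum.swap)
      finally show "0 \<le> \<dots>" .
    qed
    moreover have "\<bar>F x y\<bar> \<le> (\<Sum>i<m. \<Sum>j<m. \<bar>d i * d j * L (p i) (p j)\<bar>)" for x y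
    proof -
      have "\<bar>w * ?e i j t\<bar> \<le> \<bar>w\<bar>" if "i < m" "j < m" for w t i j
        using s[OF p[OF that(1)] p[OF that(2)]] by (simp add: abs_mult mult_left_le)
      then show ?thesis
        unfolding F_def by (intro order.trans[OF sum_abs] sum_mono) auto
    qed
    moreover have "(\<lambda>(x, y). F x y) \<in> borel_measurable (borel \<Otimes>\<^sub>M borel)"
      unfolding F_def by measurable
    ultimately have "0 \<le> (\<integral>x. (\<integral>y. F x y + F y x \<partial>gaussian_measure \<sigma>) \<partial>gaussian_measure \<sigma>)"
      using prob_space_gaussian_measure[OF that] by (intro psd_on_average) auto
    also have "\<dots> = 2 * (\<Sum>i<m. \<Sum>j<m. d i * d j * (L (p i) (p j) * I \<sigma> (p i) (p j)))"
    proof -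
      let ?w = "\<lambda>i j. d i * d j * L (p i) (p j)"
      let ?H = "\<lambda>i j x. (\<integral>y. ?e i j (x - y) \<partial>gaussian_measure \<sigma>) + (\<integral>y. ?e i j (y - x) \<partial>gaussian_measure \<sigma>)"
      have pos: "0 < s (p i) (p j)" if "i < m" "j < m" for i j using s p that by auto
      have "(\<integral>y. F x y + F y x \<partial>gaussian_measure \<sigma>) = (\<Sum>i<m. \<Sum>j<m. ?w i j * ?H i j x)" for x
      proof -
        have "(\<integral>y. F x y + F y x \<partial>gaussian_measure \<sigma>)
          = (\<integral>y. (\<Sum>i<m. \<Sum>j<m. ?w i j * (?e i j (x - y) + ?e i j (y - x))) \<partial>gaussian_measure \<sigma>)"
          unfolding F_def by (simp add: sum.distrib distrib_left)
        also have "\<dots> = (\<Sum>i<m. \<Sum>j<m. ?w i j * ?H i j x)"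
          using that pos by (intro integral_double_sum int)
        finally show ?thesis .
      qed
      then have "(\<integral>x. (\<integral>y. F x y + F y x \<partial>gaussian_measure \<sigma>) \<partial>gaussian_measure \<sigma>)
        = (\<integral>x. (\<Sum>i<m. \<Sum>j<m. ?w i j * ?H i j x) \<partial>gaussian_measure \<sigma>)" by simp
      also have "\<dots> = (\<Sum>i<m. \<Sum>j<m. ?w i j * ((\<integral>x. (\<integral>y. ?e i j (x - y) \<partial>gaussian_measure \<sigma>) \<partial>gaussian_measure \<sigma>)
          + (\<integral>x. (\<integral>y. ?e i j (y - x) \<partial>gaussian_measure \<sigma>) \<partial>gaussian_measure \<sigma>)))"
        using that pos by (intro integral_double_sum int2)
      also have "\<dots> = (\<Sum>i<m. \<Sum>j<m. ?w i j * (2 * I \<sigma> (p i) (p j)))"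
        using that p by (intro sum.cong refl) (simp add: I[simplified])
      also have "\<dots> = 2 * (\<Sum>i<m. \<Sum>j<m. d i * d j * (L (p i) (p j) * I \<sigma> (p i) (p j)))"
        by (simp add: sum_distrib_left mult_ac)
      finally show ?thesis .
    qed
    finally show "0 \<le> (\<Sum>i<m. \<Sum>j<m. d i * d j * (L (p i) (p j) * I \<sigma> (p i) (p j)))" by simp
  qed
  then have "psd_on S (\<lambda>a b. L a b * (2 * \<sigma> * I \<sigma> a b))" if "\<sigma> > 0" for \<sigma>
    using psd_on_scale[of S "\<lambda>a b. L a b * I \<sigma> a b" "2 * \<sigma>"] that by (simp add: mult_ac)
  then have "\<forall>\<^sub>F \<sigma> in at_top. psd_on S (\<lambda>a b. L a b * (2 * \<sigma> * I \<sigma> a b))"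
    by (intro eventually_mono[OF eventually_gt_at_top[of 0]])
  then show ?thesis
  proof (rule psd_on_tendsto[rotated])
    fix a b assume "a \<in> S" "b \<in> S"
    then show "((\<lambda>\<sigma>. L a b * (2 * \<sigma> * I \<sigma> a b)) \<longlongrightarrow> L a b * sqrt (s a b)) at_top"
      unfolding I_def by (intro tendsto_mult[OF tendsto_const tendsto_wide_gaussian] s)
  qed simp
qed

section \<open>The upward step\<close>

text \<open>The substitution of \<open>s * t\<close> for \<open>t\<close> in the Gamma integral,
  carried out for nonnegative integrals, where no integrability has to be shown first.\<close>

lemma gamma_integral_scaled:
  fixes \<beta> s :: real
  assumes "\<beta> > 0" "s > 0"
  shows "((\<lambda>t. indicator {0..} t * t powr (\<beta> - 1) * exp (- (s * t))) has_integral Gamma \<beta> * s powr (- \<beta>)) UNIV"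
proof -
  let ?f = "\<lambda>t. indicator {0..} t * t powr (\<beta> - 1) * exp (- (s * t))"
  have eq: "s powr (1 - \<beta>) * (indicator {0..} (s * t) * (s * t) powr (\<beta> - 1) / exp (s * t)) = ?f t" for t
  proof (cases "t \<ge> 0")
    case True
    have "(s * t) powr (\<beta> - 1) = s powr (\<beta> - 1) * t powr (\<beta> - 1)"
      by (rule powr_mult)
    moreover have "s powr (1 - \<beta>) * s powr (\<beta> - 1) = 1"
      using assms by (simp add: powr_add[symmetric])
    ultimately show ?thesis using True assms by (simp add: exp_minus field_simps)
  qed (use assms in \<open>auto simp: indicator_def zero_le_mult_iff\<close>)
  have "ennreal (Gamma \<beta>) = (\<integral>\<^sup>+t. ennreal (indicator {0..} t * t powr (\<beta> - 1) / exp t) \<partial>lborel)"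
    by (rule Gamma_conv_nn_integral_real[OF assms(1)])
  also have "\<dots> = ennreal s * (\<integral>\<^sup>+t. ennreal (indicator {0..} (s * t) * (s * t) powr (\<beta> - 1) / exp (s * t)) \<partial>lborel)"
    using assms(2) by (subst nn_integral_real_affine[of _ s 0]) auto
  finally have g: "ennreal (Gamma \<beta>) = \<dots>" .
  have "(\<integral>\<^sup>+t. ennreal (?f t) \<partial>lborel)
    = ennreal (s powr (1 - \<beta>)) * (\<integral>\<^sup>+t. ennreal (indicator {0..} (s * t) * (s * t) powr (\<beta> - 1) / exp (s * t)) \<partial>lborel)"
    unfolding eq[symmetric] by (subst nn_integral_cmult[symmetric]) (auto simp: ennreal_mult'[symmetric])
  also have "ennreal (s powr (1 - \<beta>)) = ennreal (s powr (- \<beta>)) * ennreal s"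
    using assms powr_mult_base[of s "- \<beta>"] by (simp add: ennreal_mult'[symmetric] mult.commute)
  also have "\<dots> * (\<integral>\<^sup>+t. ennreal (indicator {0..} (s * t) * (s * t) powr (\<beta> - 1) / exp (s * t)) \<partial>lborel)
    = ennreal (s powr (- \<beta>)) * ennreal (Gamma \<beta>)"
    unfolding g by (simp add: mult.assoc)
  also have "\<dots> = ennreal (Gamma \<beta> * s powr (- \<beta>))"
    using assms by (simp add: ennreal_mult' mult.commute)
  finally show ?thesis
    using assms by (intro nn_integral_has_integral) (auto simp: less_imp_le)
qed

lemma inv_form_dim_0:
  assumes "M \<in> carrier_mat 0 0" "v \<in> carrier_vec 0"
  shows "inv_form M v = 0"
proof -
  have "transpose_mat M = M" "M *\<^sub>v v = v"
    using assms by (auto intro!: eq_matI eq_vecI)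
  from inv_form_eq[OF assms(1) this(1) assms(2) this(2)] show ?thesis
    using assms(2) by (simp add: scalar_prod_def)
qed

text \<open>Kernel arguments need the blocks as functions on the index set, so they are chosen for
  all \<open>a\<close> at once.\<close>

lemma sym_pos_def_Suc_choice:
  assumes "\<And>a. a \<in> S \<Longrightarrow> sym_pos_def (Suc k) (A a)"
  obtains \<alpha> g C where "\<And>a. a \<in> S \<Longrightarrow> A a = bordered (\<alpha> a) (g a) (C a)"
    "\<And>a. a \<in> S \<Longrightarrow> g a \<in> carrier_vec k" "\<And>a. a \<in> S \<Longrightarrow> sym_pos_def k (C a)"
proof -
  have "\<exists>t. A a = bordered (fst t) (fst (snd t)) (snd (snd t)) \<and> fst (snd t) \<in> carrier_vec k
      \<and> sym_pos_def k (snd (snd t))" if "a \<in> S" for a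
    using sym_pos_def_Suc_cases[OF assms[OF that]] by (metis fst_conv snd_conv)
  then obtain t where "\<forall>a\<in>S. A a = bordered (fst (t a)) (fst (snd (t a))) (snd (snd (t a)))
      \<and> fst (snd (t a)) \<in> carrier_vec k \<and> sym_pos_def k (snd (snd (t a)))"
    by metis
  then show ?thesis
    using that[of "\<lambda>a. fst (t a)" "\<lambda>a. fst (snd (t a))" "\<lambda>a. snd (snd (t a))"] by blast
qed

lemma bordered_add_sym_pos_def:
  assumes "sym_pos_def k C" "sym_pos_def k D" "g \<in> carrier_vec k" "h \<in> carrier_vec k"
  shows "bordered a g C + bordered b h D = bordered (a + b) (g + h) (C + D)"
  using assms by (intro bordered_add) (auto dest: sym_pos_defD)

lemma inv_form_minus_smult:
  assumes "sym_pos_def k C" "x \<in> carrier_vec k" "C *\<^sub>v x = g" "q \<in> carrier_vec k"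
  shows "inv_form C (q - z \<cdot>\<^sub>v g) = inv_form C q - 2 * z * (x \<bullet> q) + z\<^sup>2 * inv_form C g"
proof -
  note C = sym_pos_defD[OF assms(1)]
  have g: "g \<in> carrier_vec k" using mult_mat_vec_carrier[OF C(1) assms(2)] assms(3) by simp
  obtain y where y: "y \<in> carrier_vec k" "C *\<^sub>v y = q" using sym_pos_def_solve[OF assms(1,4)] by blast
  have gy: "g \<bullet> y = x \<bullet> q"
    using symmetric_scalar_prod[OF C(1,2) assms(2) y(1)] y assms(3) by simp
  have qx: "q \<bullet> x = x \<bullet> q" by (rule comm_scalar_prod[OF assms(4,2)])
  have "C *\<^sub>v (y - z \<cdot>\<^sub>v x) = q - z \<cdot>\<^sub>v g"
    using assms y C(1) by (simp add: mult_minus_distrib_mat_vec[of _ k k] mult_mat_vec[of _ k k])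
  from inv_form_eq[OF C(1,2) _ this]
  have "inv_form C (q - z \<cdot>\<^sub>v g) = (q - z \<cdot>\<^sub>v g) \<bullet> (y - z \<cdot>\<^sub>v x)" using assms y by simp
  also have "\<dots> = q \<bullet> y - z * (q \<bullet> x) - z * (g \<bullet> y) + z * (z * (g \<bullet> x))"
    using assms y g
    by (simp add: minus_scalar_prod_distrib[of _ k] scalar_prod_minus_distrib[of _ k] algebra_simps)
  finally show ?thesis
    using inv_form_eq[OF C(1,2) y] inv_form_eq[OF C(1,2) assms(2,3)]
    by (simp add: gy qx power2_eq_square)
qed

text \<open>Up to a power of \<open>pi\<close>, the new factor is the integral over \<open>z\<close>
  of \<open>exp (- z \<bullet> M z + 2 (v a + v b) \<bullet> z)\<close> with
  \<open>M = A a + A b\<close>. For fixed \<open>z\<close> the integrand is a function of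
  \<open>a\<close> times the same function of \<open>b\<close>. The induction integrates one
  coordinate at a time.\<close>

lemma psd_on_exp_inv_form:
  assumes "psd_on S L" "\<And>a. a \<in> S \<Longrightarrow> sym_pos_def k (A a)" "\<And>a. a \<in> S \<Longrightarrow> v a \<in> carrier_vec k"
  shows "psd_on S (\<lambda>a b. L a b * (det (A a + A b) powr (- 1 / 2) * exp (inv_form (A a + A b) (v a + v b))))"
  using assms
proof (induction k arbitrary: L A v)
  case 0
  have "det (A a + A b) = 1" "inv_form (A a + A b) (v a + v b) = 0" if "a \<in> S" "b \<in> S" for a b
    using 0(2)[OF that(1)] 0(2)[OF that(2)] 0(3)[OF that(1)] 0(3)[OF that(2)]
    by (auto simp: sym_pos_def_def intro!: inv_form_dim_0)
  then show ?case using psd_on_cong[OF 0(1)] by simp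
next
  case (Suc k)
  obtain \<alpha> g C where A: "\<And>a. a \<in> S \<Longrightarrow> A a = bordered (\<alpha> a) (g a) (C a)"
    and g: "\<And>a. a \<in> S \<Longrightarrow> g a \<in> carrier_vec k" and C: "\<And>a. a \<in> S \<Longrightarrow> sym_pos_def k (C a)"
    using sym_pos_def_Suc_choice[of S k A] Suc.prems(2) by blast
  have "\<exists>p q. v a = vCons p q \<and> q \<in> carrier_vec k" if "a \<in> S" for a
    using Suc.prems(3)[OF that] by (cases "v a") auto
  then obtain p q where v: "\<And>a. a \<in> S \<Longrightarrow> v a = vCons (p a) (q a)"
    and q: "\<And>a. a \<in> S \<Longrightarrow> q a \<in> carrier_vec k"
    by metis
  \<comment> \<open>\<open>?e z a\<close> collects the terms of the exponent in the first coordinate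
    \<open>z\<close> alone; the cross terms turn \<open>q a\<close> into
    \<open>q a - z g a\<close>.\<close>
  let ?e = "\<lambda>z a. exp (- \<alpha> a * z\<^sup>2 + 2 * p a * z)"
  let ?K = "\<lambda>z a b. ?e z a * ?e z b * L a b * (det (C a + C b) powr (- 1 / 2)
      * exp (inv_form (C a + C b) ((q a - z \<cdot>\<^sub>v g a) + (q b - z \<cdot>\<^sub>v g b))))"
  have K: "psd_on S (?K z)" for z
    using psd_on_compose[OF Suc.prems(1), where f = "\<lambda>x. x" and g = "?e z" and T = S] g q
    by (intro Suc.IH C) auto
  let ?J = "\<lambda>a b. sqrt pi * (L a b * (det (A a + A b) powr (- 1 / 2) * exp (inv_form (A a + A b) (v a + v b))))"
  have int: "((\<lambda>z. ?K z a b) has_integral ?J a b) UNIV" if ab: "a \<in> S" "b \<in> S" for a b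
  proof -
    define M G where "M = C a + C b" and "G = g a + g b"
    define P Q where "P = p a + p b" and "Q = q a + q b"
    have M: "sym_pos_def k M" unfolding M_def using ab C by (intro sym_pos_def_add)
    have GQ: "G \<in> carrier_vec k" "Q \<in> carrier_vec k" using g q ab by (auto simp: G_def Q_def)
    have AB: "A a + A b = bordered (\<alpha> a + \<alpha> b) G M"
      using bordered_add_sym_pos_def[OF C[OF ab(1)] C[OF ab(2)] g[OF ab(1)] g[OF ab(2)]] A ab
      by (simp add: M_def G_def)
    have vv: "v a + v b = vCons P Q"
      using v ab q by (auto simp: P_def Q_def intro!: eq_vecI simp: vec_index_vCons)
    have X: "sym_pos_def (Suc k) (bordered (\<alpha> a + \<alpha> b) G M)"
      unfolding AB[symmetric] using Suc.prems(2) ab by (intro sym_pos_def_add)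
    obtain x where x: "x \<in> carrier_vec k" "M *\<^sub>v x = G" using sym_pos_def_solve[OF M GQ(1)] by blast
    define s where "s = \<alpha> a + \<alpha> b - inv_form M G"
    have s: "s > 0" using sym_pos_def_bordered_pos[OF X M GQ(1)] by (simp add: s_def)
    have dM: "det M > 0" using sym_pos_def_det_pos[OF M] .
    have qs: "(q a - z \<cdot>\<^sub>v g a) + (q b - z \<cdot>\<^sub>v g b) = Q - z \<cdot>\<^sub>v G" for z
      using g[OF ab(1)] g[OF ab(2)] q[OF ab(1)] q[OF ab(2)]
      by (auto simp: Q_def G_def algebra_simps intro!: eq_vecI)
    have eqK: "(\<lambda>z. ?K z a b) = (\<lambda>z. L a b * det M powr (- 1 / 2) * exp (inv_form M Q) * exp (- s * z\<^sup>2 + 2 * (P - x \<bullet> Q) * z))"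
    proof
      fix z
      have "?e z a * ?e z b * exp (inv_form M (Q - z \<cdot>\<^sub>v G)) = exp (inv_form M Q) * exp (- s * z\<^sup>2 + 2 * (P - x \<bullet> Q) * z)"
        unfolding inv_form_minus_smult[OF M x GQ(2)] exp_add[symmetric]
        by (simp add: s_def P_def algebra_simps)
      then show "?K z a b = L a b * det M powr (- 1 / 2) * exp (inv_form M Q) * exp (- s * z\<^sup>2 + 2 * (P - x \<bullet> Q) * z)"
        unfolding qs M_def[symmetric] by (simp add: mult_ac)
    qed
    have eqJ: "?J a b = L a b * det M powr (- 1 / 2) * exp (inv_form M Q) * (sqrt (pi / s) * exp ((P - x \<bullet> Q)\<^sup>2 / s))"
    proof -
      \<comment> \<open>The \<open>1 / sqrt s\<close> of the scalar Gaussian integral supplies the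
        Schur complement missing from \<open>det M powr (- 1 / 2)\<close>.\<close>
      have "(s * det M) powr (- 1 / 2) = det M powr (- 1 / 2) * (1 / sqrt s)"
        using s dM by (simp add: powr_mult powr_minus_divide powr_half_sqrt)
      then show ?thesis
        unfolding AB vv det_bordered[OF M GQ(1)] inv_form_bordered[OF X M GQ(1) x GQ(2)] s_def[symmetric]
        by (simp add: exp_add real_sqrt_divide mult_ac)
    qed
    show ?thesis
      unfolding eqK eqJ by (intro has_integral_mult_right gaussian_integral s)
  qed
  have "psd_on S ?J" by (rule psd_on_has_integral[OF K int])
  from psd_on_scale[OF this, of "1 / sqrt pi"] show ?case by simp
qed

text \<open>In the Gamma integral for the power of the Schur complement, the part of
  \<open>exp (- s * t)\<close> that does not split is \<open>exp (t * inv_form M G)\<close>.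
  Producing it by \<open>psd_on_exp_inv_form\<close>, with borders scaled by \<open>sqrt t\<close>,
  uses up a factor \<open>det M powr (- 1 / 2)\<close> and leaves the exponent
  \<open>\<beta> - 1 / 2\<close>.\<close>

lemma psd_on_det_powr_Suc:
  assumes psd: "psd_on {A. sym_pos_def k A} (\<lambda>A B. det (A + B) powr (- (\<beta> - 1 / 2)))" and \<beta>: "\<beta> > 0"
  shows "psd_on {A. sym_pos_def (Suc k) A} (\<lambda>A B. det (A + B) powr (- \<beta>))"
proof -
  let ?S = "{X. sym_pos_def (Suc k) X}"
  obtain \<alpha> g C where A: "\<And>a. a \<in> ?S \<Longrightarrow> a = bordered (\<alpha> a) (g a) (C a)"
    and g: "\<And>a. a \<in> ?S \<Longrightarrow> g a \<in> carrier_vec k" and C: "\<And>a. a \<in> ?S \<Longrightarrow> sym_pos_def k (C a)"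
    using sym_pos_def_Suc_choice[of ?S k "\<lambda>X. X"] by blast
  let ?K = "\<lambda>t a b. indicator {0..} t * t powr (\<beta> - 1) * (exp (- t * \<alpha> a) * exp (- t * \<alpha> b) * det (C a + C b) powr (- (\<beta> - 1 / 2))
    * (det (C a + C b) powr (- 1 / 2) * exp (inv_form (C a + C b) (sqrt t \<cdot>\<^sub>v g a + sqrt t \<cdot>\<^sub>v g b))))"
  have K: "psd_on ?S (?K t)" for t :: real
    using psd_on_compose[OF psd, where f = C and g = "\<lambda>a. exp (- t * \<alpha> a)" and T = ?S] C g
    by (intro psd_on_scale psd_on_exp_inv_form) auto
  have int: "((\<lambda>t. ?K t a b) has_integral Gamma \<beta> * det (a + b) powr (- \<beta>)) UNIV" if ab: "a \<in> ?S" "b \<in> ?S" for a b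
  proof -
    define M G where "M = C a + C b" and "G = g a + g b"
    have M: "sym_pos_def k M" unfolding M_def using ab C by (intro sym_pos_def_add)
    have G: "G \<in> carrier_vec k" using g ab by (auto simp: G_def)
    have AB: "a + b = bordered (\<alpha> a + \<alpha> b) G M"
      using bordered_add_sym_pos_def[OF C[OF ab(1)] C[OF ab(2)] g[OF ab(1)] g[OF ab(2)], of "\<alpha> a" "\<alpha> b"]
        A[OF ab(1)] A[OF ab(2)] by (simp add: M_def G_def)
    have X: "sym_pos_def (Suc k) (bordered (\<alpha> a + \<alpha> b) G M)"
      unfolding AB[symmetric] using ab by (simp add: sym_pos_def_add)
    define s where "s = \<alpha> a + \<alpha> b - inv_form M G"
    have s: "s > 0" using sym_pos_def_bordered_pos[OF X M G] by (simp add: s_def)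
    have dM: "det M > 0" using sym_pos_def_det_pos[OF M] .
    have eqK: "(\<lambda>t. ?K t a b) = (\<lambda>t. det M powr (- \<beta>) * (indicator {0..} t * t powr (\<beta> - 1) * exp (- (s * t))))"
    proof
      fix t :: real
      show "?K t a b = det M powr (- \<beta>) * (indicator {0..} t * t powr (\<beta> - 1) * exp (- (s * t)))"
      \<comment> \<open>For negative \<open>t\<close> the indicator annihilates both sides;
        \<open>t\<close> is the square of \<open>sqrt t\<close> only when
        \<open>t \<ge> 0\<close>.\<close>
      proof (cases "t \<ge> 0")
        case True
        have "sqrt t \<cdot>\<^sub>v g a + sqrt t \<cdot>\<^sub>v g b = sqrt t \<cdot>\<^sub>v G"
          unfolding G_def using g ab by (intro smult_add_distrib_vec[symmetric, of _ k]) auto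
        then have "inv_form M (sqrt t \<cdot>\<^sub>v g a + sqrt t \<cdot>\<^sub>v g b) = t * inv_form M G"
          using inv_form_smult[OF M G, of "sqrt t"] True by simp
        moreover have "exp (- t * \<alpha> a) * exp (- t * \<alpha> b) * exp (t * inv_form M G) = exp (- (s * t))"
          unfolding exp_add[symmetric] by (simp add: s_def algebra_simps)
        moreover have "det M powr (- (\<beta> - 1 / 2)) * det M powr (- 1 / 2) = det M powr (- \<beta>)"
          unfolding powr_add[symmetric] by simp
        ultimately show ?thesis unfolding M_def[symmetric] by (simp add: mult_ac)
      qed simp
    qed
    have "det (a + b) powr (- \<beta>) = det M powr (- \<beta>) * s powr (- \<beta>)"
      unfolding AB det_bordered[OF M G] s_def[symmetric] by (simp add: powr_mult mult_ac)
    then show ?thesis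
      unfolding eqK using has_integral_mult_right[OF gamma_integral_scaled[OF \<beta> s], of "det M powr (- \<beta>)"]
      by (simp add: mult_ac)
  qed
  have "psd_on ?S (\<lambda>a b. Gamma \<beta> * det (a + b) powr (- \<beta>))" by (rule psd_on_has_integral[OF K int])
  from psd_on_scale[OF this, of "1 / Gamma \<beta>"] Gamma_real_pos[OF \<beta>] show ?thesis by simp
qed

text \<open>Each dimension costs \<open>1 / 2\<close> in the exponent. The recursion stops with a
  constant kernel, in dimension 0 or at exponent 0. A half-integer cannot jump over 0, and an
  exponent above the threshold stays above it, since the threshold drops by \<open>1 / 2\<close> as
  well.\<close>

lemma psd_on_det_powr:
  assumes "(\<exists>j::nat. \<beta> = real j / 2) \<or> \<beta> > (real n - 1) / 2"
  shows "psd_on {A. sym_pos_def n A} (\<lambda>A B. det (A + B) powr (- \<beta>))"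
  using assms
proof (induction n arbitrary: \<beta>)
  case 0
  have "det (A + B) = 1" if "sym_pos_def 0 A" "sym_pos_def 0 B" for A B
    using that by (simp add: sym_pos_def_def)
  then show ?case by (intro psd_on_cong[OF psd_on_const[of 1]]) auto
next
  case (Suc n)
  show ?case
  proof (cases "\<beta> = 0")
    case True
    have "det (A + B) \<noteq> 0" if "sym_pos_def (Suc n) A" "sym_pos_def (Suc n) B" for A B
      using sym_pos_def_det_pos[OF sym_pos_def_add[OF that]] by simp
    then show ?thesis using True by (intro psd_on_cong[OF psd_on_const[of 1]]) auto
  next
    case False
    then have "\<beta> > 0" using Suc.prems by (auto intro: le_less_trans[rotated])
    have "(\<exists>j::nat. \<beta> - 1 / 2 = real j / 2) \<or> \<beta> - 1 / 2 > (real n - 1) / 2"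
    proof (cases "\<exists>j::nat. \<beta> = real j / 2")
      case True
      then obtain j :: nat where "\<beta> = real j / 2" by blast
      moreover from this False have "j \<noteq> 0" by auto
      ultimately have "\<beta> - 1 / 2 = real (j - 1) / 2" by (simp add: of_nat_diff field_simps)
      then show ?thesis by blast
    qed (use Suc.prems in \<open>auto simp: field_simps\<close>)
    then show ?thesis by (intro psd_on_det_powr_Suc Suc.IH \<open>\<beta> > 0\<close>)
  qed
qed

section \<open>The downward step\<close>

text \<open>The vector variables are averaged away one coordinate at a time. Each average
  contributes the root of a Schur complement; their product is the root of
  \<open>det (A a + A b)\<close> and cancels the given inverse root.\<close>

lemma psd_on_gaussian_marginal:
  assumes "\<And>a. a \<in> S \<Longrightarrow> sym_pos_def k (A a)"
    and "psd_on (S \<times> carrier_vec k) (\<lambda>(a, v) (b, w). L a b *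
      (det (A a + A b) powr (- 1 / 2) * exp (- inv_form (A a + A b) (v - w))))"
  shows "psd_on S L"
  using assms
proof (induction k arbitrary: A)
  case 0
  have 1: "det (A a + A b) = 1" "inv_form (A a + A b) (0\<^sub>v 0 - 0\<^sub>v 0) = 0" if "a \<in> S" "b \<in> S" for a b
    using 0(1)[OF that(1)] 0(1)[OF that(2)]
    by (auto simp: sym_pos_def_def intro!: inv_form_dim_0)
  from psd_on_compose[OF 0(2), where f = "\<lambda>a. (a, 0\<^sub>v 0)" and T = S and g = "\<lambda>_. 1"]
  have "psd_on S (\<lambda>a b. L a b * (det (A a + A b) powr (- 1 / 2) * exp (- inv_form (A a + A b) (0\<^sub>v 0 - 0\<^sub>v 0))))"
    by simp
  then show ?case by (rule psd_on_cong) (simp only: 1, simp)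
next
  case (Suc k)
  obtain \<alpha> g C where A: "\<And>a. a \<in> S \<Longrightarrow> A a = bordered (\<alpha> a) (g a) (C a)"
    and g: "\<And>a. a \<in> S \<Longrightarrow> g a \<in> carrier_vec k" and C: "\<And>a. a \<in> S \<Longrightarrow> sym_pos_def k (C a)"
    using sym_pos_def_Suc_choice[of S k A] Suc.prems(1) by blast
  have C2: "sym_pos_def k (C a + C b)" and g2: "g a + g b \<in> carrier_vec k"
    and AB: "A a + A b = bordered (\<alpha> a + \<alpha> b) (g a + g b) (C a + C b)"
    and X: "sym_pos_def (Suc k) (bordered (\<alpha> a + \<alpha> b) (g a + g b) (C a + C b))"
    if ab: "a \<in> S" "b \<in> S" for a b
  proof -
    show "sym_pos_def k (C a + C b)" using C ab by (simp add: sym_pos_def_add)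
    show "g a + g b \<in> carrier_vec k" using g ab by simp
    show *: "A a + A b = bordered (\<alpha> a + \<alpha> b) (g a + g b) (C a + C b)"
      using bordered_add_sym_pos_def[OF C[OF ab(1)] C[OF ab(2)] g[OF ab(1)] g[OF ab(2)]] A ab by simp
    show "sym_pos_def (Suc k) (bordered (\<alpha> a + \<alpha> b) (g a + g b) (C a + C b))"
      unfolding *[symmetric] using Suc.prems(1) ab by (intro sym_pos_def_add)
  qed
  have "\<forall>a b. \<exists>x. a \<in> S \<longrightarrow> b \<in> S \<longrightarrow> x \<in> carrier_vec k \<and> (C a + C b) *\<^sub>v x = g a + g b"
    using sym_pos_def_solve[OF C2 g2] by blast
  then obtain x where x: "\<And>a b. a \<in> S \<Longrightarrow> b \<in> S \<Longrightarrow> x a b \<in> carrier_vec k"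
    "\<And>a b. a \<in> S \<Longrightarrow> b \<in> S \<Longrightarrow> (C a + C b) *\<^sub>v x a b = g a + g b" by metis
  define s where "s a b = \<alpha> a + \<alpha> b - inv_form (C a + C b) (g a + g b)" for a b
  have s: "0 < s a b" if "a \<in> S" "b \<in> S" for a b
    using sym_pos_def_bordered_pos[OF X[OF that] C2[OF that] g2[OF that]] by (simp add: s_def)
  let ?D = "\<lambda>a b v w. det (C a + C b) powr (- 1 / 2) * exp (- inv_form (C a + C b) (v - w))"
  let ?L = "\<lambda>(a, v) (b, w). L a b * s a b powr (- 1 / 2) * ?D a b v w"
  \<comment> \<open>In the first coordinate the Gaussian is centred at a point that depends on all
    remaining data; \<open>psd_on_gaussian_average\<close> forgets it.\<close>
  let ?c = "\<lambda>(a, v) (b, w). x a b \<bullet> (v - w)" and ?s = "\<lambda>(a, v) (b, w). s a b"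
  have "psd_on (S \<times> carrier_vec k) (\<lambda>p q. ?L p q * sqrt (?s p q))"
  proof (rule psd_on_gaussian_average[where c = ?c])
    have base: "psd_on ((S \<times> carrier_vec k) \<times> UNIV) (\<lambda>((a, v), p) ((b, w), q). L a b *
      (det (A a + A b) powr (- 1 / 2) * exp (- inv_form (A a + A b) (vCons p v - vCons q w))))"
      using psd_on_compose[OF Suc.prems(2), where f = "\<lambda>((a, v), p). (a, vCons p v)"
          and T = "(S \<times> carrier_vec k) \<times> (UNIV :: real set)" and g = "\<lambda>_. 1"]
      by (auto simp: split_def)
    have eq: "L a b * (det (A a + A b) powr (- 1 / 2) * exp (- inv_form (A a + A b) (vCons p v - vCons q w)))
        = ?L (a, v) (b, w) * exp (- (p - q - ?c (a, v) (b, w))\<^sup>2 / ?s (a, v) (b, w))"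
      if ab: "a \<in> S" "b \<in> S" and vw: "v \<in> carrier_vec k" "w \<in> carrier_vec k" for a b v w p q
    proof -
      have vw': "v - w \<in> carrier_vec k" using vw by simp
      have vc: "vCons p v - vCons q w = vCons (p - q) (v - w)"
        using vw by (auto intro!: eq_vecI simp: vec_index_vCons)
      have E: "exp (- inv_form (A a + A b) (vCons p v - vCons q w))
        = exp (- (p - q - x a b \<bullet> (v - w))\<^sup>2 / s a b) * exp (- inv_form (C a + C b) (v - w))"
        unfolding AB[OF ab] vc
          inv_form_bordered[OF X[OF ab] C2[OF ab] g2[OF ab] x(1)[OF ab] x(2)[OF ab] vw', of "p - q"]
        by (simp add: s_def exp_add[symmetric])
      have D: "det (A a + A b) powr (- 1 / 2) = s a b powr (- 1 / 2) * det (C a + C b) powr (- 1 / 2)"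
        unfolding AB[OF ab] det_bordered[OF C2[OF ab] g2[OF ab]] s_def by (rule powr_mult)
      show ?thesis
        unfolding D E prod.case by (simp only: mult_ac)
    qed
    show "psd_on ((S \<times> carrier_vec k) \<times> UNIV)
      (\<lambda>(a, p) (b, q). ?L a b * exp (- (p - q - ?c a b)\<^sup>2 / ?s a b))"
      by (rule psd_on_cong[OF base]) (clarify, simp only: prod.case eq)
  qed (use s in auto)
  then have "psd_on (S \<times> carrier_vec k) (\<lambda>(a, v) (b, w). L a b * ?D a b v w)"
  proof (rule psd_on_cong)
    have eq: "?L (a, v) (b, w) * sqrt (?s (a, v) (b, w)) = L a b * ?D a b v w"
      if ab: "a \<in> S" "b \<in> S" for a b v w
    proof -
      have "s a b powr (- 1 / 2) * sqrt (s a b) = 1"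
        using s[OF ab] by (simp add: powr_minus_divide powr_half_sqrt)
      then show ?thesis by (simp add: mult_ac)
    qed
    show "?L x y * sqrt (?s x y) = (case x of (a, v) \<Rightarrow> \<lambda>(b, w). L a b * ?D a b v w) y"
      if "x \<in> S \<times> carrier_vec k" "y \<in> S \<times> carrier_vec k" for x y
      using that eq by (cases x; cases y) (simp only: prod.case mem_Sigma_iff)
  qed
  then show ?case by (rule Suc.IH[rotated]) (rule C)
qed

section \<open>Rank one updates and sheared matrices\<close>

definition rank_one_update :: "real mat \<Rightarrow> real \<Rightarrow> real vec \<Rightarrow> real mat" where
  "rank_one_update A c y = mat (dim_row A) (dim_row A) (\<lambda>(i, j). A $$ (i, j) + c * (y $ i * y $ j))"

lemma rank_one_update_carrier [simp]:
  "A \<in> carrier_mat k k \<Longrightarrow> rank_one_update A c y \<in> carrier_mat k k"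
  by (auto simp: rank_one_update_def)

lemma rank_one_update_mult_vec:
  assumes "A \<in> carrier_mat k k" "y \<in> carrier_vec k" "x \<in> carrier_vec k"
  shows "rank_one_update A c y *\<^sub>v x = A *\<^sub>v x + (c * (y \<bullet> x)) \<cdot>\<^sub>v y"
proof (rule eq_vecI)
  fix i assume "i < dim_vec (A *\<^sub>v x + (c * (y \<bullet> x)) \<cdot>\<^sub>v y)"
  then have i: "i < k" using assms by auto
  have "(\<Sum>j<k. (A $$ (i, j) + c * (y $ i * y $ j)) * x $ j)
    = (\<Sum>j<k. A $$ (i, j) * x $ j) + c * (\<Sum>j<k. y $ j * x $ j) * y $ i"
    by (simp add: sum.distrib algebra_simps sum_distrib_left)
  then show "(rank_one_update A c y *\<^sub>v x) $ i = (A *\<^sub>v x + (c * (y \<bullet> x)) \<cdot>\<^sub>v y) $ i"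
    using i assms by (simp add: rank_one_update_def scalar_prod_def atLeast0LessThan)
qed (use assms in \<open>auto simp: rank_one_update_def\<close>)

text \<open>The matrix determinant lemma, from computing the determinant of
  \<open>bordered (- t) v M\<close> twice: with the corner as pivot and with \<open>M\<close> as
  pivot.\<close>

lemma det_rank_one_update:
  assumes M: "sym_pos_def k M" and v: "v \<in> carrier_vec k" and t: "t \<noteq> 0"
  shows "det (rank_one_update M (1 / t) v) = (1 + inv_form M v / t) * det M"
proof -
  note Mc = sym_pos_defD(1)[OF M]
  have "mat k k (\<lambda>(i, j). M $$ (i, j) - v $ i * v $ j / (- t)) = rank_one_update M (1 / t) v"
    using Mc t by (auto simp: rank_one_update_def)
  then have "det (bordered (- t) v M) = - t * det (rank_one_update M (1 / t) v)"
    using det_bordered_corner[OF Mc v, of "- t"] t by simp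
  then have "- t * det (rank_one_update M (1 / t) v) = (- t - inv_form M v) * det M"
    using det_bordered[OF M v] by simp
  then show ?thesis using t by (simp add: field_simps)
qed

text \<open>The congruence of \<open>diag(1/t, A)\<close> by the unipotent matrix with border \<open>y\<close>; this is what makes
  determinants of sums depend on \<open>y\<close> and \<open>z\<close> through \<open>y - z\<close>.\<close>

definition sheared :: "real mat \<Rightarrow> real vec \<Rightarrow> real \<Rightarrow> real mat" where
  "sheared A y t = bordered (1 / t) ((1 / t) \<cdot>\<^sub>v y) (rank_one_update A (1 / t) y)"

lemma sym_pos_def_sheared:
  assumes A: "sym_pos_def k A" and y: "y \<in> carrier_vec k" and t: "t > 0"
  shows "sym_pos_def (Suc k) (sheared A y t)"
proof -
  note Ad = sym_pos_defD[OF A]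
  have As: "A $$ (i, j) = A $$ (j, i)" if "i < k" "j < k" for i j
    using arg_cong[OF Ad(2), of "\<lambda>M. M $$ (i, j)"] that Ad(1) by auto
  have R: "rank_one_update A (1 / t) y \<in> carrier_mat k k" using Ad(1) by simp
  have Rs: "transpose_mat (rank_one_update A (1 / t) y) = rank_one_update A (1 / t) y"
    using Ad(1) As by (intro eq_matI) (auto simp: rank_one_update_def)
  have "0 < x \<bullet> (sheared A y t *\<^sub>v x)" if x: "x \<in> carrier_vec (Suc k)" "x \<noteq> 0\<^sub>v (Suc k)" for x
  proof -
    obtain p q where xq: "x = vCons p q" and q: "q \<in> carrier_vec k" using x(1) by (cases x) auto
    have "q \<bullet> (rank_one_update A (1 / t) y *\<^sub>v q) = q \<bullet> (A *\<^sub>v q) + (1 / t) * (y \<bullet> q)\<^sup>2"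
      using Ad(1) y q
      by (simp add: rank_one_update_mult_vec[of _ k] scalar_prod_add_distrib[of _ k]
          comm_scalar_prod[OF q y] power2_eq_square)
    \<comment> \<open>In the coordinates \<open>p + y \<bullet> q\<close> and \<open>q\<close> the
      form is block diagonal, with blocks \<open>1 / t\<close> and \<open>A\<close>.\<close>
    then have eq: "x \<bullet> (sheared A y t *\<^sub>v x) = (p + y \<bullet> q)\<^sup>2 / t + q \<bullet> (A *\<^sub>v q)"
      using y q t unfolding sheared_def xq
      by (subst bordered_quadratic_form[OF R]) (simp_all add: power2_eq_square field_simps)
    show ?thesis
    proof (cases "q = 0\<^sub>v k")
      case True
      then have "p \<noteq> 0" using x(2) xq by (auto simp: zero_vec_Suc)
      then show ?thesis unfolding eq using True y t Ad(1) by simp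
    next
      case False
      then show ?thesis unfolding eq using Ad(3)[OF q] t by (simp add: add_nonneg_pos)
    qed
  qed
  then show ?thesis
    using R Rs bordered_symmetric[OF R] by (simp add: sym_pos_def_def sheared_def)
qed

text \<open>With the corner \<open>1 / t + 1 / u\<close> as pivot, the three rank one terms merge
  into the single one with vector \<open>y - z\<close> and weight \<open>1 / (t + u)\<close>; this
  is the scalar identity \<open>id\<close>, applied entrywise.\<close>

lemma det_sheared_add:
  assumes A: "sym_pos_def k A" and B: "sym_pos_def k B" and y: "y \<in> carrier_vec k" and z: "z \<in> carrier_vec k"
    and t: "t > 0" and u: "u > 0"
  shows "det (sheared A y t + sheared B z u) = det (A + B) * (t + u + inv_form (A + B) (y - z)) / (t * u)"
proof -
  note Ac = sym_pos_defD(1)[OF A] and Bc = sym_pos_defD(1)[OF B]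
  let ?a = "1 / t + 1 / u" and ?g = "(1 / t) \<cdot>\<^sub>v y + (1 / u) \<cdot>\<^sub>v z"
  let ?C = "rank_one_update A (1 / t) y + rank_one_update B (1 / u) z"
  have C: "?C \<in> carrier_mat k k" using Ac Bc by simp
  have g: "?g \<in> carrier_vec k" using y z by simp
  have a: "?a \<noteq> 0" using t u by (simp add: add_pos_pos less_imp_neq[symmetric])
  have "sheared A y t + sheared B z u = bordered ?a ?g ?C"
    unfolding sheared_def using Ac Bc y z by (intro bordered_add) auto
  then have "det (sheared A y t + sheared B z u) = ?a * det (mat k k (\<lambda>(i, j). ?C $$ (i, j) - ?g $ i * ?g $ j / ?a))"
    using det_bordered_corner[OF C g a] by simp
  also have "mat k k (\<lambda>(i, j). ?C $$ (i, j) - ?g $ i * ?g $ j / ?a) = rank_one_update (A + B) (1 / (t + u)) (y - z)"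
  proof (rule eq_matI)
    fix i j assume "i < dim_row (rank_one_update (A + B) (1 / (t + u)) (y - z))"
      "j < dim_col (rank_one_update (A + B) (1 / (t + u)) (y - z))"
    then have ij: "i < k" "j < k" using Ac Bc by (auto simp: rank_one_update_def)
    have tu: "1 / t + 1 / u = (t + u) / (t * u)" using t u by (simp add: field_simps)
    have id: "p * p' / t + q * q' / u - (p / t + q / u) * (p' / t + q' / u) / (1 / t + 1 / u)
      = (p - q) * (p' - q') / (t + u)" for p q p' q'
    proof -
      have "t * u \<noteq> 0" "t + u \<noteq> 0" using t u by auto
      then show ?thesis unfolding tu by (simp add: divide_simps) (simp add: algebra_simps)
    qed
    show "mat k k (\<lambda>(i, j). ?C $$ (i, j) - ?g $ i * ?g $ j / ?a) $$ (i, j)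
      = rank_one_update (A + B) (1 / (t + u)) (y - z) $$ (i, j)"
      using ij Ac Bc y z id[of "y $ i" "y $ j" "z $ i" "z $ j"]
      by (simp add: rank_one_update_def)
  qed (use Ac Bc in \<open>auto simp: rank_one_update_def\<close>)
  also have "det \<dots> = (1 + inv_form (A + B) (y - z) / (t + u)) * det (A + B)"
    using t u y z by (intro det_rank_one_update[of k] sym_pos_def_add A B) auto
  also have "?a * \<dots> = det (A + B) * (t + u + inv_form (A + B) (y - z)) / (t * u)"
  proof -
    have "t * u \<noteq> 0" "t + u \<noteq> 0" using t u by auto
    then show ?thesis by (simp add: divide_simps)
  qed
  finally show ?thesis .
qed

text \<open>The weights \<open>t powr (- \<beta>)\<close> and \<open>u powr (- \<beta>)\<close>
  cancel the denominator in \<open>det_sheared_add\<close>, so \<open>psd_on_exp_limit\<close>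
  applies. A factor \<open>det (A + B) powr (- 1 / 2)\<close> is then split off to normalise the
  exponential, and \<open>psd_on_gaussian_marginal\<close> removes both.\<close>

lemma psd_on_det_powr_descent:
  assumes psd: "psd_on {A. sym_pos_def (Suc k) A} (\<lambda>A B. det (A + B) powr (- \<beta>))" and \<beta>: "\<beta> > 0"
  shows "psd_on {A. sym_pos_def k A} (\<lambda>A B. det (A + B) powr (- (\<beta> - 1 / 2)))"
proof -
  let ?S = "{A. sym_pos_def k A}"
  let ?L = "\<lambda>(A, y) (B, z). det (A + B) powr (- \<beta>)" and ?Q = "\<lambda>(A, y) (B, z). inv_form (A + B) (y - z)"
  have Q: "0 \<le> ?Q p q" if "p \<in> ?S \<times> carrier_vec k" "q \<in> ?S \<times> carrier_vec k" for p q
    using that by (auto intro!: inv_form_nonneg[of k] sym_pos_def_add)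
  have base: "psd_on ((?S \<times> carrier_vec k) \<times> {0<..}) (\<lambda>((A, y), t) ((B, z), u).
      t powr (- \<beta>) * u powr (- \<beta>) * det (sheared A y t + sheared B z u) powr (- \<beta>))"
    using psd_on_compose[OF psd, where f = "\<lambda>((A, y), t). sheared A y t" and g = "\<lambda>((A, y), t). t powr (- \<beta>)"
        and T = "(?S \<times> carrier_vec k) \<times> {0<..}"] sym_pos_def_sheared
    by (auto simp: split_def)
  have eq: "t powr (- \<beta>) * u powr (- \<beta>) * det (sheared A y t + sheared B z u) powr (- \<beta>)
      = ?L (A, y) (B, z) * (t + u + ?Q (A, y) (B, z)) powr (- \<beta>)"
    if *: "sym_pos_def k A" "sym_pos_def k B" "y \<in> carrier_vec k" "z \<in> carrier_vec k" and tu: "0 < t" "0 < u"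
    for A B y z t u
  proof -
    have "det (sheared A y t + sheared B z u) powr (- \<beta>)
      = det (A + B) powr (- \<beta>) * (t + u + inv_form (A + B) (y - z)) powr (- \<beta>) / (t powr (- \<beta>) * u powr (- \<beta>))"
      unfolding det_sheared_add[OF * tu] by (simp only: powr_mult powr_divide)
    then show ?thesis using tu by simp
  qed
  have "psd_on ((?S \<times> carrier_vec k) \<times> {0<..}) (\<lambda>(a, t) (b, u). ?L a b * (t + u + ?Q a b) powr (- \<beta>))"
    by (rule psd_on_cong[OF base]) (clarify, simp only: prod.case eq mem_Collect_eq greaterThan_iff)
  then have "psd_on (?S \<times> carrier_vec k) (\<lambda>a b. ?L a b * exp (- ?Q a b))"
    using Q \<beta> by (rule psd_on_exp_limit)
  then have "psd_on (?S \<times> carrier_vec k) (\<lambda>(A, v) (B, w). det (A + B) powr (- (\<beta> - 1 / 2)) *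
      (det (A + B) powr (- 1 / 2) * exp (- inv_form (A + B) (v - w))))"
    by (rule psd_on_cong) (auto simp: powr_add[symmetric] simp flip: mult.assoc)
  then show ?thesis by (intro psd_on_gaussian_marginal[where A = "\<lambda>A. A" and k = k]) auto
qed

text \<open>The scalar matrices \<open>1 / 2\<close> and \<open>3 / 2\<close> give a 2 by 2 kernel
  matrix with diagonal \<open>1\<close>, \<open>3 powr p\<close> and off-diagonal
  \<open>2 powr p\<close>, where \<open>p > 0\<close>. Its determinant
  \<open>3 powr p - 4 powr p\<close> is negative.\<close>

lemma not_psd_on_det_powr_neg:
  assumes "n \<ge> 1" "\<beta> < 0"
  shows "\<not> psd_on {A. sym_pos_def n A} (\<lambda>A B. det (A + B) powr (- \<beta>))"
proof
  assume psd: "psd_on {A. sym_pos_def n A} (\<lambda>A B. det (A + B) powr (- \<beta>))"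
  define p where "p = real n * (- \<beta>)"
  have p: "p > 0" using assms by (simp add: p_def mult_pos_neg)
  have spd: "sym_pos_def n (a \<cdot>\<^sub>m 1\<^sub>m n)" if "a > 0" for a :: real
  proof -
    have "0 < x \<bullet> ((a \<cdot>\<^sub>m 1\<^sub>m n) *\<^sub>v x)" if x: "x \<in> carrier_vec n" "x \<noteq> 0\<^sub>v n" for x
    proof -
      have "(a \<cdot>\<^sub>m 1\<^sub>m n) *\<^sub>v x = a \<cdot>\<^sub>v x"
        using x(1) by (intro eq_vecI) (auto simp: row_smult)
      moreover have "0 < x \<bullet> x" 
      proof -
        obtain i where "i < n" "x $ i \<noteq> 0"
          using x by (metis carrier_vecD eq_vecI index_zero_vec)
        then show ?thesis
          using x(1) unfolding scalar_prod_def by (intro sum_pos2[of _ i]) (auto simp: zero_less_mult_iff linorder_neq_iff)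
      qed
      ultimately show ?thesis using x(1) \<open>a > 0\<close> by simp
    qed
    then show ?thesis by (auto simp: sym_pos_def_def)
  qed
  have det: "det (a \<cdot>\<^sub>m 1\<^sub>m n + b \<cdot>\<^sub>m 1\<^sub>m n) powr (- \<beta>) = (a + b) powr p" if "a > 0" "b > 0" for a b :: real
  proof -
    have "a \<cdot>\<^sub>m 1\<^sub>m n + b \<cdot>\<^sub>m 1\<^sub>m n = (a + b) \<cdot>\<^sub>m (1\<^sub>m n :: real mat)" by (auto simp: algebra_simps)
    moreover have "(a + b) ^ n = (a + b) powr real n" using that by (simp add: powr_realpow)
    ultimately show ?thesis by (simp add: det_smult powr_powr p_def)
  qed
  define x where "x i = (if i = 0 then 1 / 2 else 3 / 2 :: real) \<cdot>\<^sub>m 1\<^sub>m n" for i :: nat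
  \<comment> \<open>These coefficients are orthogonal to the first row \<open>(1, 2 powr p)\<close>,
    so the form reduces to the determinant.\<close>
  define c where "c i = (if i = 0 then 2 powr p else - 1 :: real)" for i :: nat
  have "0 \<le> (\<Sum>i<2. \<Sum>j<2. c i * c j * det (x i + x j) powr (- \<beta>))"
    by (rule psd_onD[OF psd]) (auto simp: x_def spd)
  also have "\<dots> = 3 powr p - 2 powr p * 2 powr p"
    by (simp add: numeral_2_eq_2 x_def c_def det power2_eq_square algebra_simps)
  also have "\<dots> = 3 powr p - 4 powr p" by (simp flip: powr_mult)
  also have "\<dots> < 0" using p by (simp add: powr_less_mono2)
  finally show False by simp
qed

text \<open>Negative exponents are excluded at every stage, so the descent can only stop at exponent
  0 or in dimension 1, where a nonnegative exponent is zero or above the threshold 0. Adding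
  \<open>1 / 2\<close> back preserves both alternatives.\<close>

lemma psd_on_det_powr_imp:
  assumes "psd_on {A. sym_pos_def n A} (\<lambda>A B. det (A + B) powr (- \<beta>))" "n \<ge> 1"
  shows "(\<exists>j::nat. \<beta> = real j / 2) \<or> \<beta> > (real n - 1) / 2"
  using assms
proof (induction n arbitrary: \<beta>)
  case (Suc n)
  have nonneg: "\<beta> \<ge> 0" using not_psd_on_det_powr_neg[OF Suc.prems(2), of \<beta>] Suc.prems(1) by force
  show ?case
  proof (cases "\<beta> = 0 \<or> n = 0")
    case True
    then show ?thesis using nonneg by (cases "\<beta> = 0") (auto intro: exI[of _ 0])
  next
    case False
    then have "psd_on {A. sym_pos_def n A} (\<lambda>A B. det (A + B) powr (- (\<beta> - 1 / 2)))"
      using nonneg Suc.prems(1) by (intro psd_on_det_powr_descent) auto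
    from Suc.IH[OF this] False have "(\<exists>j::nat. \<beta> - 1 / 2 = real j / 2) \<or> \<beta> - 1 / 2 > (real n - 1) / 2" by auto
    then show ?thesis
    proof
      assume "\<exists>j::nat. \<beta> - 1 / 2 = real j / 2"
      then obtain j :: nat where "\<beta> = real (Suc j) / 2" 
        by (metis add.commute add_divide_distrib diff_add_cancel of_nat_Suc)
      then show ?thesis by blast
    qed (simp add: field_simps)
  qed
qed simp

section \<open>The theorem\<close>

text \<open>By symmetry the cross terms between real and imaginary parts cancel, so the complex form
  is the sum of the real forms at the two parts.\<close>

lemma pos_semidef_of_real_iff:
  assumes sym: "\<And>i j. i < m \<Longrightarrow> j < m \<Longrightarrow> f i j = f j i"
  shows "pos_semidef (map_mat complex_of_real (mat m m (\<lambda>(i, j). f i j)))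
    \<longleftrightarrow> (\<forall>c. 0 \<le> (\<Sum>i<m. \<Sum>j<m. c i * c j * f i j))"
proof -
  let ?H = "map_mat complex_of_real (mat m m (\<lambda>(i, j). f i j))"
  let ?q = "\<lambda>c. \<Sum>i<m. \<Sum>j<m. c i * c j * f i j"
  have form: "conjugate c \<bullet> (?H *\<^sub>v c) = complex_of_real (?q (\<lambda>i. Re (c $ i)) + ?q (\<lambda>i. Im (c $ i)))"
    if c: "c \<in> carrier_vec m" for c
  proof -
    have "conjugate c \<bullet> (?H *\<^sub>v c) = (\<Sum>i<m. \<Sum>j<m. cnj (c $ i) * c $ j * complex_of_real (f i j))"
      using c by (simp add: scalar_prod_def atLeast0LessThan sum_distrib_left mult_ac)
    also have "\<dots> = complex_of_real (?q (\<lambda>i. Re (c $ i)) + ?q (\<lambda>i. Im (c $ i)))"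
    proof (rule complex_eqI)
      have "(\<Sum>i<m. \<Sum>j<m. Re (c $ i) * Im (c $ j) * f i j) = (\<Sum>i<m. \<Sum>j<m. Re (c $ j) * Im (c $ i) * f j i)"
        by (rule sum.swap)
      also have "\<dots> = (\<Sum>i<m. \<Sum>j<m. Im (c $ i) * Re (c $ j) * f i j)"
        using sym by (intro sum.cong refl) (simp add: mult_ac)
      finally show "Im (\<Sum>i<m. \<Sum>j<m. cnj (c $ i) * c $ j * complex_of_real (f i j))
        = Im (complex_of_real (?q (\<lambda>i. Re (c $ i)) + ?q (\<lambda>i. Im (c $ i))))"
        by (simp add: sum_subtractf algebra_simps)
    qed (simp add: sum.distrib algebra_simps)
    finally show ?thesis .
  qed
  have "pos_semidef ?H \<longleftrightarrow> (\<forall>c \<in> carrier_vec m. 0 \<le> ?q (\<lambda>i. Re (c $ i)) + ?q (\<lambda>i. Im (c $ i)))"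
    using form by (auto simp: pos_semidef_def less_eq_complex_def)
  also have "\<dots> \<longleftrightarrow> (\<forall>c. 0 \<le> ?q c)"
  proof safe
    fix c :: "nat \<Rightarrow> real"
    assume *: "\<forall>c \<in> carrier_vec m. 0 \<le> ?q (\<lambda>i. Re (c $ i)) + ?q (\<lambda>i. Im (c $ i))"
    show "0 \<le> ?q c"
      \<comment> \<open>For a vector with real entries the imaginary summand vanishes.\<close>
      using *[rule_format, of "vec m (\<lambda>i. complex_of_real (c i))"] by simp
  qed auto
  finally show ?thesis .
qed

theorem theorem3p10:
  fixes n :: nat and \<beta> :: real
  assumes "n \<ge> 1" and "\<beta> > 0"
  shows "(\<forall>m::nat. \<forall>X :: nat \<Rightarrow> real mat.
            m \<ge> 1 \<longrightarrow> (\<forall>i<m. sym_pos_def n (X i)) \<longrightarrow>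
            pos_semidef (map_mat complex_of_real (det_power_mat \<beta> m X)))
     \<longleftrightarrow> \<beta> \<in> {real j / 2 | j::nat. 1 \<le> j \<and> j \<le> n - 1} \<union> {\<gamma>::real. \<gamma> > (real n - 1) / 2}"
    (is "?lhs \<longleftrightarrow> ?rhs")
proof -
  have psd: "pos_semidef (map_mat complex_of_real (det_power_mat \<beta> m X))
      \<longleftrightarrow> (\<forall>c. 0 \<le> (\<Sum>i<m. \<Sum>j<m. c i * c j * det (X i + X j) powr (- \<beta>)))"
    if "\<forall>i<m. sym_pos_def n (X i)" for m X
    unfolding det_power_mat_def
  proof (rule pos_semidef_of_real_iff)
    fix i j assume "i < m" "j < m"
    then have "X i + X j = X j + X i"
      using that by (intro comm_add_mat[of _ n n]) (auto dest: sym_pos_defD(1))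
    then show "det (X i + X j) powr (- \<beta>) = det (X j + X i) powr (- \<beta>)" by simp
  qed
  have "?lhs \<longleftrightarrow> psd_on {A. sym_pos_def n A} (\<lambda>A B. det (A + B) powr (- \<beta>))"
  proof
    assume lhs: ?lhs
    show "psd_on {A. sym_pos_def n A} (\<lambda>A B. det (A + B) powr (- \<beta>))"
    proof (rule psd_onI)
      fix m :: nat and X :: "nat \<Rightarrow> real mat" and c :: "nat \<Rightarrow> real"
      assume X: "\<And>i. i < m \<Longrightarrow> X i \<in> {A. sym_pos_def n A}"
      show "0 \<le> (\<Sum>i<m. \<Sum>j<m. c i * c j * det (X i + X j) powr (- \<beta>))"
        \<comment> \<open>\<open>psd_on\<close> also ranges over \<open>m = 0\<close>, where the sum
          is empty.\<close>
        using lhs[rule_format, of m X] psd[of m X] X by (cases m) auto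
    qed
  next
    assume "psd_on {A. sym_pos_def n A} (\<lambda>A B. det (A + B) powr (- \<beta>))"
    then show ?lhs using psd by (auto intro!: psd_onD)
  qed
  also have "\<dots> \<longleftrightarrow> (\<exists>j::nat. \<beta> = real j / 2) \<or> \<beta> > (real n - 1) / 2"
    using psd_on_det_powr psd_on_det_powr_imp assms(1) by blast
  \<comment> \<open>A half-integer \<open>j / 2\<close> not above the threshold has
    \<open>j \<le> n - 1\<close>, and \<open>\<beta> > 0\<close> excludes \<open>j = 0\<close>; the
    larger half-integers already lie in the second set.\<close>
  also have "\<dots> \<longleftrightarrow> ?rhs"
  proof
    assume *: "(\<exists>j::nat. \<beta> = real j / 2) \<or> \<beta> > (real n - 1) / 2"
    show ?rhs
    proof (cases "\<beta> > (real n - 1) / 2")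
      case False
      then obtain j :: nat where j: "\<beta> = real j / 2" using * by blast
      have "1 \<le> j" using j assms(2) by (cases j) auto
      moreover have "j \<le> n - 1" using j False assms(1) by (simp add: of_nat_diff field_simps)
      ultimately show ?thesis using j by blast
    qed simp
  qed auto
  finally show ?thesis .
qed

end
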